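(* If $q>2$ is even, there is a unique equivalence class of non-trivial perfect $\mathbb{F}_q$-linear MSRD codes in $M_{3\times3}(\mathbb{F}_q)$, i.e. of $3$-dimensional $\mathbb{F}_q$-subspaces of symmetric $3\times3$ matrices over $\mathbb{F}_q$ in which every nonzero matrix has rank $3$; if $q$ is odd, there are exactly two such equivalence classes.
   Context: An $\mathbb{F}_q$-linear symmetric rank-distance code is an $\mathbb{F}_q$-subspace of the space of symmetric $3\times3$ matrices over $\mathbb{F}_q$, with minimum distance the minimum rank of its nonzero elements. For minimum distance $3$ the maximal dimension is $3$ (MSRD codes), and the non-trivial perfect $\mathbb{F}_q$-linear SRD codes in $M_{3\times3}(\mathbb{F}_q)$ are exactly these $3$-dimensional codes of minimum distance $3$. Two codes $C,C'$ are equivalent if $C'=\{AXB:X\in C\}$ for some $A,B\in\mathrm{GL}(3,q)$. *)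

theory Defs
  imports "HOL-Analysis.Analysis"
begin

text \<open>
  The library's \<^term>\<open>(*s)\<close> on \<open>'a^'n^'m\<close> takes scalars in \<open>'a^'n\<close>, so the \<open>'a\<close>-vector space
  structure on matrices is introduced here.
\<close>

definition mat_scale :: "'a::field \<Rightarrow> 'a^'n^'m \<Rightarrow> 'a^'n^'m" where
  "mat_scale c X = (\<chi> i j. c * X $ i $ j)"

interpretation matvs: vector_space "mat_scale :: 'a::field \<Rightarrow> 'a^'n^'m \<Rightarrow> 'a^'n^'m"
  by unfold_locales (simp_all add: mat_scale_def vec_eq_iff algebra_simps)

definition linear_srd_code :: "('a::field^3^3) set \<Rightarrow> bool" where
  "linear_srd_code C \<longleftrightarrow> matvs.subspace C \<and> (\<forall>X\<in>C. transpose X = X)"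

text \<open>
  The \<open>3\<close>-dimensional linear symmetric rank-distance codes of minimum distance \<open>3\<close>; for
  finite \<open>'a\<close> these are the non-trivial perfect linear codes of symmetric \<open>3 \<times> 3\<close> matrices.
\<close>

definition perfect_msrd_codes :: "('a::field^3^3) set set" where
  "perfect_msrd_codes =
    {C. linear_srd_code C \<and> matvs.dim C = 3 \<and> (\<forall>X\<in>C. X \<noteq> 0 \<longrightarrow> rank X = 3)}"

definition code_equivalent :: "('a::field^3^3) set \<Rightarrow> ('a^3^3) set \<Rightarrow> bool" where
  "code_equivalent C C' \<longleftrightarrow>
    (\<exists>A B. invertible A \<and> invertible B \<and> C' = {A ** X ** B | X. X \<in> C})"

definition perfect_msrd_equiv :: "(('a::field^3^3) set \<times> ('a^3^3) set) set" where
  "perfect_msrd_equiv =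
    {(C, C'). C \<in> perfect_msrd_codes \<and> C' \<in> perfect_msrd_codes \<and> code_equivalent C C'}"

lemma code_equivalent_refl: "code_equivalent C C"
  unfolding code_equivalent_def
  by (rule exI[of _ "mat 1"], rule exI[of _ "mat 1"]) (auto simp: invertible_def)

lemma code_equivalent_sym:
  assumes "code_equivalent C C'"
  shows "code_equivalent C' C"
proof -
  obtain A B where AB: "invertible A" "invertible B" and C': "C' = {A ** X ** B | X. X \<in> C}"
    using assms unfolding code_equivalent_def by blast
  obtain A' where A': "A ** A' = mat 1" "A' ** A = mat 1"
    using AB(1) unfolding invertible_def by blast
  obtain B' where B': "B ** B' = mat 1" "B' ** B = mat 1"
    using AB(2) unfolding invertible_def by blast
  have inv: "A' ** (A ** X ** B) ** B' = X" for X
  proof -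
    have "A' ** (A ** X ** B) ** B' = (A' ** A) ** X ** (B ** B')"
      by (simp only: matrix_mul_assoc)
    then show ?thesis by (simp add: A' B')
  qed
  have "C = {A' ** X ** B' | X. X \<in> C'}"
  proof -
    have "{A' ** X ** B' | X. X \<in> C'} = {A' ** (A ** X ** B) ** B' | X. X \<in> C}"
      unfolding C' by blast
    then show ?thesis by (simp add: inv)
  qed
  moreover have "invertible A'" "invertible B'"
    using A' B' unfolding invertible_def by blast+
  ultimately show ?thesis
    unfolding code_equivalent_def by blast
qed

lemma code_equivalent_trans:
  assumes "code_equivalent C C'" "code_equivalent C' C''"
  shows "code_equivalent C C''"
proof -
  obtain A B where AB: "invertible A" "invertible B" and C': "C' = {A ** X ** B | X. X \<in> C}"
    using assms(1) unfolding code_equivalent_def by blast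
  obtain P Q where PQ: "invertible P" "invertible Q" and C'': "C'' = {P ** X ** Q | X. X \<in> C'}"
    using assms(2) unfolding code_equivalent_def by blast
  have eq: "P ** (A ** X ** B) ** Q = (P ** A) ** X ** (B ** Q)" for X
    by (simp only: matrix_mul_assoc)
  have "C'' = {(P ** A) ** X ** (B ** Q) | X. X \<in> C}"
    unfolding C'' C' eq[symmetric] by blast
  moreover have "invertible (P ** A)" "invertible (B ** Q)"
    using AB PQ by (auto intro: invertible_mult)
  ultimately show ?thesis
    unfolding code_equivalent_def by blast
qed

lemma equiv_perfect_msrd: "equiv perfect_msrd_codes perfect_msrd_equiv"
proof (rule equivI)
  show "perfect_msrd_equiv \<subseteq> perfect_msrd_codes \<times> perfect_msrd_codes"
    by (auto simp: perfect_msrd_equiv_def)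
  show "refl_on perfect_msrd_codes perfect_msrd_equiv"
    by (auto simp: refl_on_def perfect_msrd_equiv_def code_equivalent_refl)
  show "sym perfect_msrd_equiv"
    by (auto simp: sym_def perfect_msrd_equiv_def intro: code_equivalent_sym)
  show "trans perfect_msrd_equiv"
    by (auto simp: trans_def perfect_msrd_equiv_def intro: code_equivalent_trans)
qed

end

theory Submission
  imports "HOL-Algebra.Algebraic_Closure_Type" Defs
begin

text \<open>
  Let \<open>q = |F|\<close>, let \<open>K\<close> be the cubic extension of \<open>F\<close> and write \<open>x', x''\<close> for the conjugates of
  \<open>x\<close>. Two independent codewords \<open>A, B\<close> form a pencil without singular members, so \<open>B\<inverse> A\<close> has three
  conjugate eigenvectors over \<open>K\<close>. With respect to these, symmetric matrices over \<open>F\<close> become the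
  matrices \<open>H(a, b)\<close> with diagonal \<open>a, a', a''\<close> and off-diagonal entries \<open>b, b', b''\<close>, while \<open>A\<close> and \<open>B\<close>
  become diagonal. If \<open>b = 0\<close> for all codewords, the code is \<open>{H(a, 0)}\<close>, the field code. Otherwise
  rescaling the eigenvectors gives a third basis codeword with \<open>b = 1\<close>, and since
  \<open>det H(1 + w, 1) = N(w) (1 + Tr (1 / w))\<close>, nonsingularity says that a certain equation
  \<open>Tr v * Tr (c / v) = m\<close> has no solution \<open>v\<close> in \<open>K\<close>. This equation defines a plane cubic curve, and a
  Stepanov-type argument shows that it is solvable for \<open>q > 2\<close> unless \<open>c = m\<close> lies in \<open>F\<close>. In that
  case the code is \<open>{H(a, b) | b \<in> F, Tr a = 2 b}\<close>, which is nonsingular exactly for odd \<open>q\<close>. It is not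
  equivalent to the field code, in which quotients of codewords commute.
\<close>

no_notation fps_nth (infixl "$" 75)

section \<open>Dual numbers and double roots\<close>

datatype 'a dual = Dual (dual_val: 'a) (dual_eps: 'a)

instantiation dual :: (comm_ring_1) comm_ring_1
begin

definition zero_dual :: "'a dual" where "0 = Dual 0 0"
definition one_dual :: "'a dual" where "1 = Dual 1 0"
definition plus_dual :: "'a dual \<Rightarrow> 'a dual \<Rightarrow> 'a dual" where
  "u + v = Dual (dual_val u + dual_val v) (dual_eps u + dual_eps v)"
definition minus_dual :: "'a dual \<Rightarrow> 'a dual \<Rightarrow> 'a dual" where
  "u - v = Dual (dual_val u - dual_val v) (dual_eps u - dual_eps v)"
definition uminus_dual :: "'a dual \<Rightarrow> 'a dual" where
  "- u = Dual (- dual_val u) (- dual_eps u)"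
definition times_dual :: "'a dual \<Rightarrow> 'a dual \<Rightarrow> 'a dual" where
  "u * v = Dual (dual_val u * dual_val v) (dual_val u * dual_eps v + dual_eps u * dual_val v)"

instance
  by standard
    (auto simp: zero_dual_def one_dual_def plus_dual_def minus_dual_def uminus_dual_def
       times_dual_def algebra_simps)

end

lemmas dual_defs = zero_dual_def one_dual_def plus_dual_def minus_dual_def uminus_dual_def
  times_dual_def

lemma Dual_power:
  "Dual a b ^ n = Dual (a ^ n) (of_nat n * a ^ (n - 1) * b)" for a b :: "'a::comm_ring_1"
proof (induction n)
  case (Suc n)
  then show ?case
    by (cases n) (simp_all add: dual_defs algebra_simps)
qed (simp add: dual_defs)

text \<open>The value of \<open>p\<close> at y + eps, where eps^2 = 0. As this is a ring
  homomorphism in \<open>p\<close>, algebraic identities between polynomials carry first derivatives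
  along.\<close>

definition dual_poly :: "'a::idom \<Rightarrow> 'a poly \<Rightarrow> 'a dual" where
  "dual_poly y p = Dual (poly p y) (poly (pderiv p) y)"

lemma dual_poly_add [simp]: "dual_poly y (p + r) = dual_poly y p + dual_poly y r"
  and dual_poly_diff [simp]: "dual_poly y (p - r) = dual_poly y p - dual_poly y r"
  and dual_poly_minus [simp]: "dual_poly y (- p) = - dual_poly y p"
  and dual_poly_mult [simp]: "dual_poly y (p * r) = dual_poly y p * dual_poly y r"
  and dual_poly_0 [simp]: "dual_poly y 0 = 0"
  and dual_poly_1 [simp]: "dual_poly y 1 = 1"
  by (auto simp: dual_poly_def dual_defs pderiv_add pderiv_diff pderiv_minus pderiv_mult
      algebra_simps)

lemma dual_poly_power [simp]: "dual_poly y (p ^ n) = dual_poly y p ^ n"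
  by (induction n) auto

lemma dual_poly_of_nat [simp]: "dual_poly y (of_nat n) = of_nat n"
  by (induction n) auto

lemma dual_poly_numeral [simp]: "dual_poly y (numeral n) = numeral n"
  using dual_poly_of_nat[of y "numeral n"] by simp

lemma order_ge_2_if_dual_poly_eq_0:
  fixes p :: "'a::idom poly"
  assumes "dual_poly a p = 0" "p \<noteq> 0"
  shows "2 \<le> order a p"
proof -
  have p: "poly p a = 0" "poly (pderiv p) a = 0"
    using assms by (auto simp: dual_poly_def zero_dual_def)
  obtain r where r: "p = [:-a, 1:] * r"
    using p(1) by (auto simp: poly_eq_0_iff_dvd)
  have "poly r a = 0"
    using p(2) unfolding r pderiv_mult by (simp add: pderiv_pCons)
  then obtain s where s: "r = [:-a, 1:] * s"
    by (auto simp: poly_eq_0_iff_dvd)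
  have "p = [:-a, 1:] ^ 2 * s"
    unfolding r s power2_eq_square by (simp only: mult.assoc)
  then show ?thesis
    using assms(2) order_divides[of a 2 p] by auto
qed

text \<open>Over an algebraically closed field the multiplicities of the roots add up to the degree,
  and a root at which the derivative is nonzero has multiplicity 1.\<close>

lemma card_roots_eq_degree:
  fixes p :: "'a::alg_closed_field poly"
  assumes "p \<noteq> 0" "\<And>a. poly p a = 0 \<Longrightarrow> poly (pderiv p) a \<noteq> 0"
  shows "card {a. poly p a = 0} = degree p"
proof -
  have 1: "order a p = 1" if "poly p a = 0" for a
  proof -
    have "order a p \<noteq> 0"
      using that assms(1) by (simp add: order_root)
    moreover have "\<not> 2 \<le> order a p"
    proof
      assume "2 \<le> order a p"
      then have "[:-a, 1:] ^ 2 dvd p"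
        using order_divides by blast
      then obtain s where s: "p = [:-a, 1:] ^ 2 * s" ..
      have "poly (pderiv p) a = 0"
        unfolding s power2_eq_square pderiv_mult by simp
      with assms(2) that show False
        by blast
    qed
    ultimately show ?thesis
      by linarith
  qed
  obtain A where A: "size A = degree p" "p = smult (lead_coeff p) (\<Prod>x\<in>#A. [:-x, 1:])"
    using alg_closed_imp_factorization[OF assms(1)] by blast
  have "proots (\<Prod>x\<in>#A. [:-x, 1:]) = A"
  proof (induction A)
    case (add x A)
    have "(\<Prod>x\<in>#A. [:-x, 1:]) \<noteq> 0"
      by (auto simp: prod_mset_zero_iff)
    then show ?case
      using add by (simp add: proots_mult del: mult_pCons_left)
  qed simp
  then have "proots p = A"
    using A(2) assms(1) by (metis proots_smult leading_coeff_0_iff)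
  then have size: "size (proots p) = degree p"
    using A(1) by simp
  have "size (proots p) = (\<Sum>a\<in>{a. poly p a = 0}. order a p)"
    using assms(1) by (simp add: size_multiset_overloaded_eq)
  also have "\<dots> = card {a. poly p a = 0}"
    by (simp add: 1)
  finally show ?thesis
    using size by simp
qed

lemma double_roots_le_degree:
  fixes p :: "'a::idom poly"
  assumes "p \<noteq> 0" "\<And>a. a \<in> S \<Longrightarrow> dual_poly a p = 0"
  shows "2 * card S \<le> degree p"
proof -
  have S: "S \<subseteq> {a. poly p a = 0}"
    using assms(2) by (auto simp: dual_poly_def zero_dual_def)
  have fin: "finite {a. poly p a = 0}"
    using assms(1) by (rule poly_roots_finite)
  have "2 * card S = (\<Sum>a\<in>S. 2)"
    by simp
  also have "\<dots> \<le> (\<Sum>a\<in>S. order a p)"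
    by (intro sum_mono order_ge_2_if_dual_poly_eq_0 assms)
  also have "\<dots> \<le> (\<Sum>a\<in>{a. poly p a = 0}. order a p)"
    by (rule sum_mono2[OF fin S]) auto
  also have "\<dots> = size (proots p)"
    using assms(1) by (simp add: size_multiset_overloaded_eq)
  also have "\<dots> \<le> degree p"
    by (rule size_proots_le)
  finally show ?thesis .
qed

section \<open>Frobenius-fixed points on a plane cubic curve\<close>

text \<open>
  Let \<open>\<phi>(x, y, z) = (z\<^sup>q, x\<^sup>q, y\<^sup>q)\<close>, a map of the curve
  \<open>(x + y + z) (c\<^sub>1 y z + c\<^sub>2 z x + c\<^sub>3 x y) = m x y z\<close> to itself, and suppose that it has no fixed point on
  the curve. In the chart \<open>z = 1\<close> the equation is \<open>L x\<^sup>2 + M x + N = 0\<close> with \<open>L, M, N\<close> polynomials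
  in \<open>y\<close>; let \<open>\<theta>\<close> exchange the two points with the same \<open>y\<close>. The \<open>2 q + 2\<close> roots of
  \<open>h = L + M y\<^sup>q + N y\<^bsup>2 q\<^esup>\<close> belong to the points \<open>P\<close> with \<open>\<phi>(P) = \<theta>(P)\<close>; they are simple, because at a
  double root \<open>\<theta>(P) = P\<close>. The linear form of the tangent at \<open>\<theta>(P)\<close>, evaluated at \<open>\<phi>(P)\<close>, vanishes
  there to second order, since \<open>\<phi>\<close> has derivative \<open>0\<close>. The polynomial \<open>W\<close> below is
  \<open>L\<^bsup>q + 2\<^esup>\<close> times the norm of this function; so \<open>W\<close> has \<open>2 q + 2\<close> double roots, but its
  degree is at most \<open>3 q + 6 < 4 q + 4\<close>.

  In the next identity \<open>X1\<close> and \<open>X2\<close> stand for \<open>L x\<close> at the two points over \<open>y\<close>, \<open>Y\<close> for \<open>y\<^sup>q\<close>, and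
  \<open>A1, A2, Lq, Mq, Nq\<close> for the \<open>q\<close>-th powers of \<open>X1, X2, L, M, N\<close>.
\<close>

lemma norm_identity:
  fixes L M N L' M' N' y Y Lq Mq Nq X1 X2 A1 A2 :: "'a::comm_ring_1"
  assumes X: "X1 + X2 = - M" "X1 * X2 = L * N"
    and A: "A1 + A2 = - Mq" "A1 * A2 = Lq * Nq"
    and a: "a = L * M' - L' * M" and b: "b = L * N' - L' * N"
    and h: "h = L + M * Y + N * Y\<^sup>2" and hq: "Y * h = Nq + Mq * (y * Y) + Lq * (y * Y)\<^sup>2"
    and D: "D = (X1 - X2)\<^sup>2" and Dq: "Dq = (X1 - X2) * (A1 - A2)"
    and E: "E = (X1 - X2) * (X2 * A1 - X1 * A2)"
    and W: "W = (a * (M' * N - N' * M) + b\<^sup>2) * (Y * h) - D * Lq * (L * h - y * Y * (a + b * Y))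
      + (L * b - a * Y * N + b * M * Y) * Dq + (a + b * Y) * E"
  shows "L\<^sup>2 * Lq * W =
      ((X1 - X2) * Lq * L * (L - X1 * Y) + (a * X1 + L * b) * (A2 - y * Y * Lq)) *
      ((X2 - X1) * Lq * L * (L - X2 * Y) + (a * X2 + L * b) * (A1 - y * Y * Lq))"
    (is "_ = (?f1 * ?u1 + ?g1 * ?w2) * (?f2 * ?u2 + ?g2 * ?w1)")
proof -
  have M: "M = - (X1 + X2)"
    using X(1) by simp
  have Mq: "Mq = - (A1 + A2)"
    using A(1) by simp
  \<comment> \<open>Products of conjugate factors are symmetric in \<open>X1\<close> and
    \<open>X2\<close>, hence expressions in \<open>L\<close>, \<open>M\<close>, \<open>N\<close>.
    The mixed products \<open>?u1 * ?g2\<close> and \<open>?u2 * ?g1\<close> are not symmetric, but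
    \<open>L\<close> can be taken out of them, which lets \<open>L\<^sup>2 * Lq\<close> be split off
    the whole product.\<close>
  have "?u1 * ?u2 = L\<^sup>2 - L * (X1 + X2) * Y + (X1 * X2) * Y\<^sup>2"
    by (simp add: algebra_simps power2_eq_square)
  also have "\<dots> = L * h"
    unfolding X h by (simp add: algebra_simps power2_eq_square)
  finally have 1: "?u1 * ?u2 = L * h" .
  have "?w1 * ?w2 = A1 * A2 - (A1 + A2) * (y * Y) * Lq + (y * Y)\<^sup>2 * Lq\<^sup>2"
    by (simp add: algebra_simps power2_eq_square)
  also have "\<dots> = Lq * (Y * h)"
    unfolding A hq by (simp add: algebra_simps power2_eq_square)
  finally have 2: "?w1 * ?w2 = Lq * (Y * h)" .
  have "?g1 * ?g2 = a\<^sup>2 * (X1 * X2) + a * L * b * (X1 + X2) + L\<^sup>2 * b\<^sup>2"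
    by (simp add: algebra_simps power2_eq_square)
  also have "\<dots> = a * (a * (L * N) - L * b * M) + L\<^sup>2 * b\<^sup>2"
    unfolding X by (simp add: algebra_simps power2_eq_square)
  also have "a * (L * N) - L * b * M = L\<^sup>2 * (M' * N - N' * M)"
    unfolding a b by (simp add: power2_eq_square algebra_simps)
  also have "a * \<dots> + L\<^sup>2 * b\<^sup>2 = L\<^sup>2 * (a * (M' * N - N' * M) + b\<^sup>2)"
    by (simp add: algebra_simps)
  finally have 3: "?g1 * ?g2 = L\<^sup>2 * (a * (M' * N - N' * M) + b\<^sup>2)" .
  have "?u1 * ?g2 = L * (a * X2 + L * b - b * Y * X1) - a * Y * (X1 * X2)"
    by (simp add: algebra_simps)
  then have 4: "?u1 * ?g2 = L * (a * X2 + L * b - a * Y * N - b * Y * X1)"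
    unfolding X by (simp add: algebra_simps)
  have "?u2 * ?g1 = L * (a * X1 + L * b - b * Y * X2) - a * Y * (X1 * X2)"
    by (simp add: algebra_simps)
  then have 5: "?u2 * ?g1 = L * (a * X1 + L * b - a * Y * N - b * Y * X2)"
    unfolding X by (simp add: algebra_simps)
  let ?r = "a * (M' * N - N' * M) + b\<^sup>2"
  have "(?f1 * ?u1 + ?g1 * ?w2) * (?f2 * ?u2 + ?g2 * ?w1) =
      (X1 - X2) * Lq * L * ((X2 - X1) * Lq * L) * (?u1 * ?u2) + (?g1 * ?g2) * (?w1 * ?w2)
      + (X1 - X2) * Lq * L * ((?u1 * ?g2) * ?w1 - (?u2 * ?g1) * ?w2)"
    by (simp add: algebra_simps)
  also have "\<dots> = (X1 - X2) * Lq * L * ((X2 - X1) * Lq * L) * (L * h) + (L\<^sup>2 * ?r) * (Lq * (Y * h))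
      + (X1 - X2) * Lq * L * (L * (a * X2 + L * b - a * Y * N - b * Y * X1) * ?w1
         - L * (a * X1 + L * b - a * Y * N - b * Y * X2) * ?w2)"
    by (simp only: 1 2 3 4 5)
  also have "\<dots> = L\<^sup>2 * Lq * (?r * (Y * h) - D * Lq * (L * h - y * Y * (a + b * Y))
      + (L * b - a * Y * N - b * (X1 + X2) * Y) * Dq + (a + b * Y) * E)"
    unfolding D Dq E by (simp add: algebra_simps power2_eq_square)
  also have "L * b - a * Y * N - b * (X1 + X2) * Y = L * b - a * Y * N + b * M * Y"
    using X(1) by (simp add: algebra_simps)
  finally show ?thesis
    unfolding W by (rule sym)
qed


text \<open>If \<open>X1\<close>, \<open>X2\<close> are the roots of X^2 + M X + P, then (X1 - X2)
  (X1^n - X2^n) is symmetric in them and obeys this recursion. It thus becomes a polynomial in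
  \<open>y\<close>, although \<open>X1\<close> and \<open>X2\<close> are not.\<close>

fun lucas_diff :: "'a::comm_ring_1 \<Rightarrow> 'a \<Rightarrow> nat \<Rightarrow> 'a" where
  "lucas_diff M P 0 = 0"
| "lucas_diff M P (Suc 0) = M\<^sup>2 - 4 * P"
| "lucas_diff M P (Suc (Suc n)) = - M * lucas_diff M P (Suc n) - P * lucas_diff M P n"

lemma lucas_diff_eq:
  assumes "X1 + X2 = - M" "X1 * X2 = P"
  shows "lucas_diff M P n = (X1 - X2) * (X1 ^ n - X2 ^ n)"
proof -
  have M: "M = - (X1 + X2)"
    using assms(1) by simp
  show ?thesis
    unfolding M assms(2)[symmetric]
  proof (induction n rule: induct_nat_012)
    case (ge2 n)
    show ?case
      unfolding lucas_diff.simps ge2 by (simp add: algebra_simps)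
  qed (simp_all add: power2_eq_square algebra_simps)
qed

lemma dual_poly_lucas_diff [simp]:
  "dual_poly y (lucas_diff M P n) = lucas_diff (dual_poly y M) (dual_poly y P) n"
  by (induction M P n rule: lucas_diff.induct) simp_all

lemma poly_lucas_diff [simp]: "poly (lucas_diff M P n) y = lucas_diff (poly M y) (poly P y) n"
  by (induction M P n rule: lucas_diff.induct) simp_all

lemma degree_lucas_diff_le:
  assumes "degree M \<le> 2" "degree P \<le> 3"
  shows "degree (lucas_diff M P n) \<le> 2 * n + 2"
  using assms
proof (induction M P n rule: lucas_diff.induct)
  case (2 M P)
  have "degree (M\<^sup>2) \<le> 4"
    using degree_power_le[of M 2] 2 by simp
  moreover have "degree (4 * P) \<le> 4"
    using degree_mult_le[of 4 P] 2 by simp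
  ultimately show ?case
    by (simp add: degree_diff_le)
next
  case (3 M P n)
  have "degree (M * lucas_diff M P (Suc n)) \<le> 2 * Suc (Suc n) + 2"
    using degree_mult_le[of M "lucas_diff M P (Suc n)"] 3 by simp
  moreover have "degree (P * lucas_diff M P n) \<le> 2 * Suc (Suc n) + 2"
    using degree_mult_le[of P "lucas_diff M P n"] 3 by simp
  ultimately show ?case
    by (simp add: degree_diff_le)
qed simp

lemma dual_mult_eq_0:
  fixes w :: "'a::idom dual"
  assumes "Dual a b * w = 0" "a \<noteq> 0"
  shows "w = 0"
  using assms by (cases w) (auto simp: dual_defs)


text \<open>The point with coordinates \<open>v\<close>, \<open>v ^ q\<close>,
  \<open>v ^ q\<^sup>2\<close> is a fixed point of \<phi>. In the excluded case all c_i equal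
  \<open>m\<close> and the cubic splits into the three lines x + y = 0, y + z = 0, z + x =
  0.\<close>

theorem cubic_curve_has_frobenius_fixed_point:
  fixes c1 c2 c3 m :: "'k::alg_closed_field"
  assumes frob: "\<And>x y::'k. (x + y) ^ q = x ^ q + y ^ q" and q0: "of_nat q = (0::'k)" and q: "2 < q"
    and c: "c1 ^ q = c2" "c2 ^ q = c3" "c3 ^ q = c1" "c1 \<noteq> 0"
    and m: "m ^ q = m" and ns: "\<not> (c1 = c2 \<and> m = c1)"
  shows "\<exists>v. v \<noteq> 0 \<and> v ^ q ^ 3 = v \<and>
    (v + v ^ q + v ^ q\<^sup>2) * (c1 * v ^ q * v ^ q\<^sup>2 + c2 * v ^ q\<^sup>2 * v + c3 * v * v ^ q) =
    m * v * v ^ q * v ^ q\<^sup>2"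
proof (rule ccontr)
  assume none: "\<not> ?thesis"
  have c0: "c2 \<noteq> 0" "c3 \<noteq> 0"
    using c q by auto
  have fdiff: "(x - y) ^ q = x ^ q - y ^ q" for x y :: 'k
    using frob[of "x - y" y] by (simp add: algebra_simps)
  have fminus: "(- x) ^ q = - (x ^ q)" for x :: 'k
    using fdiff[of 0 x] q by simp
  have finj: "x = y" if "x ^ q = y ^ q" for x y :: 'k
    using fdiff[of x y] that q by simp
  have f2: "(2::'k) ^ q = 2"
    using frob[of 1 1] by simp
  \<comment> \<open>Putting z = 1 in the cubic and ordering by powers of x gives \<open>L\<close>,
    \<open>M\<close>, \<open>N\<close>, where \<open>mu\<close> is the coefficient of x y. Primes
    denote derivatives in y.\<close>
  define mu where "mu = c1 + c2 + c3 - m"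
  have mu: "mu ^ q = mu"
    unfolding mu_def by (simp add: frob fdiff c m)
  define L where "L = [:c2, c3:]"
  define M where "M = [:c2, mu, c3:]"
  define N where "N = [:0, c1, c1:]"
  define L' where "L' = [:c3:]"
  define M' where "M' = [:mu, 2 * c3:]"
  define N' where "N' = [:c1, 2 * c1:]"
  define x where "x = [:0, 1 :: 'k:]"
  define Y where "Y = x ^ q"
  define h where "h = L + M * Y + N * Y\<^sup>2"
  define a where "a = L * M' - L' * M"
  define b where "b = L * N' - L' * N"
  \<comment> \<open>This is the \<open>W\<close> of \<open>norm_identity\<close> with
    \<open>D\<close>, \<open>Dq\<close> and \<open>E\<close> rewritten as polynomials. For
    \<open>E\<close>, the product \<open>X1 * X2 = L * N\<close> is taken out of X2 X1^q - X1 X2^q,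
    leaving exponent q - 1.\<close>
  define W where "W = (a * (M' * N - N' * M) + b\<^sup>2) * (Y * h)
      - lucas_diff M (L * N) 1 * L ^ q * (L * h - x * Y * (a + b * Y))
      + (L * b - a * Y * N + b * M * Y) * lucas_diff M (L * N) q
      + (a + b * Y) * (L * N * lucas_diff M (L * N) (q - 1))"
  have dY: "dual_poly y Y = Dual (y ^ q) 0" for y
    unfolding Y_def x_def dual_poly_power
    by (simp add: dual_poly_def Dual_power pderiv_pCons q0)
  have dq: "Dual u u' ^ q = Dual (u ^ q) 0" for u u' :: 'k
    by (simp add: Dual_power q0)
  have dx: "dual_poly y x = Dual y 1" for y
    by (simp add: dual_poly_def x_def pderiv_pCons)
  have dL: "dual_poly y L = Dual (c2 + c3 * y) c3"
    and dM: "dual_poly y M = Dual (c2 + mu * y + c3 * y\<^sup>2) (mu + 2 * c3 * y)"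
    and dN: "dual_poly y N = Dual (c1 * y + c1 * y\<^sup>2) (c1 + 2 * c1 * y)" for y
    by (simp_all add: dual_poly_def L_def M_def N_def pderiv_pCons algebra_simps power2_eq_square)

  have root: "dual_poly y W = 0 \<and> poly (pderiv h) y \<noteq> 0" if hy: "poly h y = 0" for y
  proof -
    define l where "l = c2 + c3 * y"
    define k where "k = c2 + mu * y + c3 * y\<^sup>2"
    define n where "n = c1 * y + c1 * y\<^sup>2"
    define z where "z = y ^ q"
    have hz: "l + k * z + n * z\<^sup>2 = 0"
      using hy by (simp add: h_def L_def M_def N_def Y_def x_def l_def k_def n_def z_def
          algebra_simps power2_eq_square)
    have y0: "y \<noteq> 0"
      using hz c0 q by (auto simp: l_def k_def n_def z_def power_0_left)
    then have z0: "z \<noteq> 0"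
      by (simp add: z_def)
    have lq: "l ^ q = c3 + c1 * z" and kq: "k ^ q = c3 + mu * z + c1 * z\<^sup>2"
      and nq: "n ^ q = c2 * z + c2 * z\<^sup>2"
      by (simp_all add: l_def k_def n_def z_def frob power_mult_distrib c mu
          flip: power_mult, simp_all add: mult.commute)
    \<comment> \<open>Here P = (x2, y) and \<theta>(P) = (x1, y). In the chart, \<phi>(P) = (1 /
      y^q, x2^q / y^q), so \<phi>(P) = \<theta>(P) means x1 = 1 / z and x2^q = y z.\<close>
    obtain x2 where x2: "x2 ^ q = y * z"
      using nth_root_exists[of q "y * z"] q by auto
    define x1 where "x1 = 1 / z"
    have e1: "l * x1\<^sup>2 + k * x1 + n = 0"
      using hz z0 by (simp add: x1_def field_simps power2_eq_square)
    \<comment> \<open>The q-th power of the equation at P is, up to a power of \<open>z\<close>, the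
      equation at \<phi>(P) = \<theta>(P).\<close>
    have "(l * x2\<^sup>2 + k * x2 + n) ^ q = l ^ q * (x2 ^ q)\<^sup>2 + k ^ q * x2 ^ q + n ^ q"
      by (simp add: frob power_mult_distrib flip: power_mult, simp add: mult.commute)
    also have "\<dots> = z * (l + k * z + n * z\<^sup>2)"
      unfolding lq kq nq x2 by (simp add: l_def k_def n_def algebra_simps power2_eq_square)
    finally have e2: "l * x2\<^sup>2 + k * x2 + n = 0"
      using hz by simp
    have ne: "x1 \<noteq> x2"
    proof
      assume eq: "x1 = x2"
      \<comment> \<open>If x1 = x2, then P is fixed by \<phi>. The scalar \<open>r\<close> is chosen
        so that r (x1, y, 1) = (v, v^q, v^(q^2)), which produces the forbidden
        \<open>v\<close>.\<close>
      obtain r where r: "r ^ (q - 1) = 1 / z"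
        using nth_root_exists[of "q - 1" "1 / z"] q by auto
      have r0: "r \<noteq> 0"
        using r z0 q by (auto simp: power_0_left)
      have rq: "r ^ q = r / z"
        using r q by (cases q) (simp_all add: field_simps)
      define v where "v = r ^ q"
      have v1: "v ^ q = r * y"
      proof -
        have "v = r * x2"
          unfolding v_def rq eq[symmetric] x1_def by simp
        then have "v ^ q = r ^ q * (y * z)"
          by (simp add: power_mult_distrib x2)
        then show ?thesis
          using z0 by (simp add: rq)
      qed
      have v2: "v ^ q\<^sup>2 = r"
      proof -
        have "v ^ q\<^sup>2 = (r * y) ^ q"
          by (simp add: power2_eq_square power_mult v1)
        also have "\<dots> = r"
          using z0 by (simp add: power_mult_distrib rq z_def[symmetric])
        finally show ?thesis .
      qed
      have v3: "v ^ q ^ 3 = v"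
        using v2 by (simp add: power3_eq_cube power2_eq_square power_mult v_def)
      have v: "v = r * x1"
        by (simp add: v_def rq x1_def)
      have "v \<noteq> 0"
        using r0 by (simp add: v_def)
      moreover have "(v + v ^ q + v ^ q\<^sup>2) * (c1 * v ^ q * v ^ q\<^sup>2 + c2 * v ^ q\<^sup>2 * v + c3 * v * v ^ q)
          - m * v * v ^ q * v ^ q\<^sup>2 = r ^ 3 * (l * x1\<^sup>2 + k * x1 + n)"
        unfolding v1 v2 unfolding v l_def k_def n_def mu_def
        by (simp add: algebra_simps power2_eq_square power3_eq_cube)
      ultimately show False
        using none v3 e1 by auto
    qed
    have s: "l * (x1 + x2) + k = 0"
    proof -
      have "(x1 - x2) * (l * (x1 + x2) + k) = (l * x1\<^sup>2 + k * x1 + n) - (l * x2\<^sup>2 + k * x2 + n)"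
        by (simp add: algebra_simps power2_eq_square)
      then have "(x1 - x2) * (l * (x1 + x2) + k) = 0"
        unfolding e1 e2 by simp
      then show ?thesis
        using ne by simp
    qed
    have "l * (x1 * x2) - n = x1 * (l * (x1 + x2) + k) - (l * x1\<^sup>2 + k * x1 + n)"
      by (simp add: algebra_simps power2_eq_square)
    then have p: "l * (x1 * x2) = n"
      unfolding s e1 by simp
    \<comment> \<open>If l = 0, Vieta's relations give k = n = 0, so the cubic contains the line y =
      -1. This leads to the excluded case.\<close>
    have l0: "l \<noteq> 0"
    proof
      assume l: "l = 0"
      with s p have kn: "k = 0" "n = 0"
        by auto
      then have "c1 * (y * (y + 1)) = 0"
        by (simp add: n_def power2_eq_square algebra_simps)
      with y0 c(4) have y: "y = -1"
        by (simp add: add_eq_0_iff2)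
      with l have "c2 = c3"
        by (simp add: l_def)
      then have "c1 = c2"
        using c by (metis finj)
      moreover have "m = c1"
        using kn(1) \<open>c2 = c3\<close> y unfolding k_def mu_def by simp
      ultimately show False
        using ns by simp
    qed
    define X1 where "X1 = l * x1"
    define X2 where "X2 = l * x2"
    have X: "X1 + X2 = - k" "X1 * X2 = l * n"
      using s p by (simp_all add: X1_def X2_def algebra_simps eq_neg_iff_add_eq_0)
    have X12: "X1 - X2 \<noteq> 0"
      using ne l0 by (simp add: X1_def X2_def)
    have X1z: "X1 * z = l"
      using z0 by (simp add: X1_def x1_def)
    have X2n: "X2 = n * z"
      using X(2) X1z l0 by (metis mult.assoc mult.commute mult_cancel_left)
    \<comment> \<open>The derivative of \<open>X1\<close> with respect to y, found by
      differentiating X^2 + M X + L N = 0 and using 2 X1 + k = X1 - X2. It lifts the two roots to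
      dual numbers \<open>U1\<close> and \<open>U2\<close>.\<close>
    define t where "t = - ((mu + 2 * c3 * y) * X1 + (c3 * n + l * (c1 + 2 * c1 * y))) / (X1 - X2)"
    have t: "(X1 - X2) * t = - ((mu + 2 * c3 * y) * X1 + (c3 * n + l * (c1 + 2 * c1 * y)))"
      using X12 by (simp add: t_def)
    define U1 where "U1 = Dual X1 t"
    define U2 where "U2 = Dual X2 (- (mu + 2 * c3 * y) - t)"
    note d = dL[of y, folded l_def] dM[of y, folded k_def] dN[of y, folded n_def] dY[of y, folded z_def]
    have U: "U1 + U2 = - dual_poly y M" "U1 * U2 = dual_poly y L * dual_poly y N"
      using X t by (simp_all add: U1_def U2_def d dual_defs algebra_simps)
    have Uq: "U1 ^ q + U2 ^ q = - (dual_poly y M ^ q)"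
      "U1 ^ q * U2 ^ q = dual_poly y L ^ q * dual_poly y N ^ q"
    proof -
      have "X1 ^ q + X2 ^ q = - (k ^ q)"
        using X(1) by (metis frob fminus)
      then show "U1 ^ q + U2 ^ q = - (dual_poly y M ^ q)"
        by (simp add: U1_def U2_def d dq) (simp add: dual_defs)
      show "U1 ^ q * U2 ^ q = dual_poly y L ^ q * dual_poly y N ^ q"
        by (metis U(2) power_mult_distrib)
    qed
    have hq: "dual_poly y Y * dual_poly y h = dual_poly y N ^ q
        + dual_poly y M ^ q * (dual_poly y x * dual_poly y Y)
        + dual_poly y L ^ q * (dual_poly y x * dual_poly y Y)\<^sup>2"
      unfolding h_def
      by (simp add: d dx dq lq kq nq)
        (simp add: dual_defs power2_eq_square l_def k_def n_def algebra_simps)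
    have E: "dual_poly y L * dual_poly y N * lucas_diff (dual_poly y M) (dual_poly y L * dual_poly y N) (q - 1)
        = (U1 - U2) * (U2 * U1 ^ q - U1 * U2 ^ q)"
      unfolding lucas_diff_eq[OF U] unfolding U(2)[symmetric] using q
      by (cases q) (simp_all add: algebra_simps)
    have dL': "dual_poly y L' = Dual c3 0" and dM': "dual_poly y M' = Dual (mu + 2 * c3 * y) (2 * c3)"
      and dN': "dual_poly y N' = Dual (c1 + 2 * c1 * y) (2 * c1)"
      by (simp_all add: dual_poly_def L'_def M'_def N'_def pderiv_pCons algebra_simps)
    \<comment> \<open>The identity is applied in the ring of dual numbers. \<open>?F1\<close> is L^2
      L^q Y times the tangent form at \<theta>(P) evaluated at \<phi>(P), and \<open>?F2\<close> is
      its conjugate.\<close>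
    have "dual_poly y L ^ 2 * dual_poly y L ^ q * dual_poly y W =
      ((U1 - U2) * dual_poly y L ^ q * dual_poly y L * (dual_poly y L - U1 * dual_poly y Y)
        + (dual_poly y a * U1 + dual_poly y L * dual_poly y b)
          * (U2 ^ q - dual_poly y x * dual_poly y Y * dual_poly y L ^ q)) *
      ((U2 - U1) * dual_poly y L ^ q * dual_poly y L * (dual_poly y L - U2 * dual_poly y Y)
        + (dual_poly y a * U2 + dual_poly y L * dual_poly y b)
          * (U1 ^ q - dual_poly y x * dual_poly y Y * dual_poly y L ^ q))" (is "_ = ?F1 * ?F2")
    proof (rule norm_identity[OF U Uq _ _ _ hq])
      show "dual_poly y a = dual_poly y L * dual_poly y M' - dual_poly y L' * dual_poly y M"
        by (simp add: a_def)
      show "dual_poly y b = dual_poly y L * dual_poly y N' - dual_poly y L' * dual_poly y N"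
        by (simp add: b_def)
      show "dual_poly y h = dual_poly y L + dual_poly y M * dual_poly y Y + dual_poly y N * (dual_poly y Y)\<^sup>2"
        by (simp add: h_def)
      show "dual_poly y W = (dual_poly y a * (dual_poly y M' * dual_poly y N - dual_poly y N' * dual_poly y M)
          + (dual_poly y b)\<^sup>2) * (dual_poly y Y * dual_poly y h)
        - (U1 - U2)\<^sup>2 * dual_poly y L ^ q * (dual_poly y L * dual_poly y h
            - dual_poly y x * dual_poly y Y * (dual_poly y a + dual_poly y b * dual_poly y Y))
        + (dual_poly y L * dual_poly y b - dual_poly y a * dual_poly y Y * dual_poly y N
            + dual_poly y b * dual_poly y M * dual_poly y Y) * ((U1 - U2) * (U1 ^ q - U2 ^ q))
        + (dual_poly y a + dual_poly y b * dual_poly y Y) * ((U1 - U2) * (U2 * U1 ^ q - U1 * U2 ^ q))"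
        unfolding W_def dual_poly_add dual_poly_diff dual_poly_mult dual_poly_power dual_poly_lucas_diff E
        unfolding lucas_diff_eq[OF U] by (simp add: power2_eq_square)
    qed auto
    \<comment> \<open>Since X1 z = l and X2^q = y z l^q, both brackets in \<open>?F1\<close> have
      value 0. Only their infinitesimal parts remain, and these cancel by the tangent
      condition.\<close>
    also have "?F1 = 0"
    proof -
      define a0 where "a0 = l * (mu + 2 * c3 * y) - c3 * k"
      define b0 where "b0 = l * (c1 + 2 * c1 * y) - c3 * n"
      obtain a1 b1 where da: "dual_poly y a = Dual a0 a1" and db: "dual_poly y b = Dual b0 b1"
        unfolding a_def b_def a0_def b0_def by (simp add: d dL' dM' dN' dual_defs)
      have X2q: "X2 ^ q = y * z * l ^ q"
        by (simp add: X2_def power_mult_distrib x2)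
      have "(X1 - X2) * (c3 - t * z) * l = (a0 * X1 + l * b0) * z"
      proof -
        have "(X1 - X2) * (c3 - t * z) = (X1 - X2) * c3 - ((X1 - X2) * t) * z"
          by (simp add: algebra_simps)
        also have "\<dots> = (X1 - X2) * c3 + (mu + 2 * c3 * y) * (X1 * z) + (c3 * n + l * (c1 + 2 * c1 * y)) * z"
          unfolding t by (simp add: algebra_simps)
        \<comment> \<open>Adding a multiple of X2 - n z = 0 turns X1 - X2 into the symmetric X1 +
          X2.\<close>
        also have "\<dots> = (2 * c3) * (X2 - n * z) + ((X1 - X2) * c3 + (mu + 2 * c3 * y) * (X1 * z) + (c3 * n + l * (c1 + 2 * c1 * y)) * z)"
          using X2n by simp
        also have "\<dots> = (X1 + X2) * c3 + (mu + 2 * c3 * y) * (X1 * z) + b0 * z"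
          unfolding b0_def by (simp add: algebra_simps)
        also have "\<dots> = a0 + b0 * z"
          unfolding X(1) X1z a0_def by (simp add: algebra_simps)
        finally have "(X1 - X2) * (c3 - t * z) = a0 + b0 * z" .
        moreover have "(a0 * X1 + l * b0) * z = a0 * (X1 * z) + l * b0 * z"
          by (simp add: algebra_simps)
        then have "(a0 * X1 + l * b0) * z = (a0 + b0 * z) * l"
          unfolding X1z by (simp add: algebra_simps)
        ultimately show ?thesis
          by simp
      qed
      then have "l ^ q * ((X1 - X2) * (c3 - t * z) * l) = l ^ q * ((a0 * X1 + l * b0) * z)"
        by (rule arg_cong)
      then show ?thesis
        unfolding U1_def U2_def dq d dx da db
        by (simp add: dual_defs X1z X2q) (simp add: algebra_simps)
    qed
    finally have "dual_poly y L ^ 2 * dual_poly y L ^ q * dual_poly y W = 0"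
      by simp
    moreover have "\<exists>e. dual_poly y L ^ 2 * dual_poly y L ^ q = Dual (l\<^sup>2 * l ^ q) e"
      by (simp add: d dq) (simp add: dual_defs power2_eq_square)
    ultimately have "dual_poly y W = 0"
      using l0 by (auto intro: dual_mult_eq_0)
    \<comment> \<open>The derivative of \<open>h\<close> is the q-th power of the x-derivative of
      the curve equation at P, which is nonzero because P and \<theta>(P) differ.\<close>
    moreover have "poly (pderiv h) y = (k + 2 * l * x2) ^ q"
    proof -
      have "poly (pderiv h) y = dual_eps (dual_poly y h)"
        by (simp add: dual_poly_def)
      also have "\<dots> = c3 + (mu + 2 * c3 * y) * z + (c1 + 2 * c1 * y) * z\<^sup>2"
        unfolding h_def by (simp add: d) (simp add: dual_defs power2_eq_square)
      also have "\<dots> = k ^ q + 2 * l ^ q * (y * z)"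
        unfolding kq lq by (simp add: algebra_simps power2_eq_square)
      also have "\<dots> = (k + 2 * l * x2) ^ q"
        by (simp add: frob power_mult_distrib f2 x2)
      finally show ?thesis .
    qed
    moreover have "k + 2 * l * x2 \<noteq> 0"
    proof -
      have "k + 2 * l * x2 = l * (x2 - x1)"
        using s by (simp add: algebra_simps add_eq_0_iff2)
      then show ?thesis
        using l0 ne by simp
    qed
    ultimately show ?thesis
      by simp
  qed

  have degY: "degree Y = q"
    by (simp add: Y_def x_def degree_power_eq)
  have degh: "degree h = 2 * q + 2"
  proof -
    have "degree (N * Y\<^sup>2) = 2 * q + 2"
    proof -
      have "N \<noteq> 0" "degree N = 2" "Y \<noteq> 0"
        using c(4) by (simp_all add: N_def Y_def x_def)
      then show ?thesis
        by (simp add: degree_mult_eq degree_power_eq degY)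
    qed
    moreover have "degree (M * Y) \<le> q + 2"
      using degree_mult_le[of M Y] by (simp add: degY M_def split: if_splits)
    moreover have "degree L \<le> 1"
      by (simp add: L_def)
    ultimately show ?thesis
      unfolding h_def using q
      by (subst degree_add_eq_right) (auto intro: le_less_trans[OF degree_add_le_max])
  qed
  then have h0: "h \<noteq> 0"
    by auto
  have W0: "W \<noteq> 0"
  \<comment> \<open>The value at y = 0 has the factor c1 - c2. When this is zero, the value at y =
    -1 has the factor (m - c1)^3. Both factors vanish only in the excluded case.\<close>
  proof (cases "c1 = c2")
    case False
    have Y0: "poly Y 0 = 0"
      using q by (simp add: Y_def x_def power_0_left)
    have D: "lucas_diff c2 0 n = - c2 * (- c2) ^ n" if "n > 0" for n
      using lucas_diff_eq[of "- c2" 0 c2 0 n] that by (simp add: power_0_left)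
    have "poly W 0 = c2 ^ q * c2 ^ 3 * (c1 - c2)"
      unfolding W_def a_def b_def h_def using q
      by (simp add: Y0 D fminus)
        (simp add: L_def M_def N_def L'_def M'_def N'_def x_def algebra_simps power2_eq_square
          power3_eq_cube fminus D)
    then show ?thesis
      using c0 False by auto
  next
    case True
    then have c': "c2 = c1" "c3 = c1"
      using c by auto
    have Y1: "poly Y (- 1) = - 1"
      by (simp add: Y_def x_def fminus)
    have "poly W (- 1) = - (c1\<^sup>2 * (m - c1) ^ 3)"
      unfolding W_def a_def b_def h_def using q
      by (simp add: Y1)
        (simp add: L_def M_def N_def L'_def M'_def N'_def x_def mu_def c' power_0_left
          algebra_simps power2_eq_square power3_eq_cube)
    moreover have "m \<noteq> c1"
      using True ns by simp
    ultimately show ?thesis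
      using c(4) by auto
  qed
  have degW: "degree W \<le> 3 * q + 6"
  proof -
    note dm = order_trans[OF degree_mult_le]
    note dp = order_trans[OF degree_power_le]
    have dL: "degree L \<le> 1" and dM: "degree M \<le> 2" and dN: "degree N \<le> 2"
      and dx: "degree x \<le> 1"
      by (simp_all add: L_def M_def N_def x_def)
    have "a = [:c2 * mu - c2 * c3, 2 * c2 * c3, c3\<^sup>2:]" and "b = [:c1 * c2, 2 * c1 * c2, c1 * c3:]"
      and r: "M' * N - N' * M = [:- c1 * c2, - 2 * c1 * c2, c1 * (c3 - mu):]"
      by (simp_all add: a_def b_def L_def M_def N_def L'_def M'_def N'_def algebra_simps power2_eq_square)
    then have da: "degree a \<le> 2" and db: "degree b \<le> 2" and dr: "degree (M' * N - N' * M) \<le> 2"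
      by (simp_all add: r)
    \<comment> \<open>The y^3 terms cancel in both differences, as they do in
      \<open>M' * N - N' * M\<close>. These cancellations give the bound 3 q + 6 instead of 3 q + 7,
      which matters for q = 3.\<close>
    have LM: "L * M - x * a = [:c2\<^sup>2, 2 * c2 * c3, c3 * mu - c2 * c3:]"
      and LN: "L * N - x * b = [:0, 0, c1 * (c3 - c2):]"
      by (simp_all add: a_def b_def L_def M_def N_def L'_def M'_def N'_def x_def algebra_simps power2_eq_square)
    have "L * h - x * Y * (a + b * Y) = L\<^sup>2 + (L * M - x * a) * Y + (L * N - x * b) * Y\<^sup>2"
      by (simp add: h_def algebra_simps power2_eq_square)
    also have "degree \<dots> \<le> 2 * q + 2"
      unfolding LM LN
    proof (intro degree_add_le)
      show "degree (L\<^sup>2) \<le> 2 * q + 2"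
        by (rule dp) (use dL in simp)
      show "degree ([:c2\<^sup>2, 2 * c2 * c3, c3 * mu - c2 * c3:] * Y) \<le> 2 * q + 2"
        by (rule dm) (simp add: degY)
      have "degree (Y\<^sup>2) \<le> 2 * q"
        by (rule dp) (simp add: degY)
      then show "degree ([:0, 0, c1 * (c3 - c2):] * Y\<^sup>2) \<le> 2 * q + 2"
        by (intro dm) simp
    qed
    finally have d1: "degree (L * h - x * Y * (a + b * Y)) \<le> 2 * q + 2" .
    have dP: "degree (L * N) \<le> 3"
      by (rule dm) (use dL dN in simp)
    note dD = degree_lucas_diff_le[OF dM dP]
    have t1: "degree ((a * (M' * N - N' * M) + b\<^sup>2) * (Y * h)) \<le> 3 * q + 6"
    proof -
      have "degree (a * (M' * N - N' * M)) \<le> 4"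
        by (rule dm) (use da dr in simp)
      moreover have "degree (b\<^sup>2) \<le> 4"
        by (rule dp) (use db in simp)
      ultimately have "degree (a * (M' * N - N' * M) + b\<^sup>2) \<le> 4"
        by (rule degree_add_le)
      moreover have "degree (Y * h) \<le> 3 * q + 2"
        by (rule dm) (simp add: degY degh)
      ultimately show ?thesis
        by (intro dm) simp
    qed
    have t2: "degree (lucas_diff M (L * N) 1 * L ^ q * (L * h - x * Y * (a + b * Y))) \<le> 3 * q + 6"
    proof -
      have "degree (L ^ q) \<le> q"
        by (rule dp) (use dL in simp)
      then have "degree (lucas_diff M (L * N) 1 * L ^ q) \<le> q + 4"
        using dD[of 1] by (intro dm) simp
      then show ?thesis
        using d1 by (intro dm) simp
    qed
    have t3: "degree ((L * b - a * Y * N + b * M * Y) * lucas_diff M (L * N) q) \<le> 3 * q + 6"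
    proof -
      have "degree (a * Y) \<le> q + 2" "degree (b * M) \<le> 4" "degree (L * b) \<le> 3"
        by (rule dm; use da db dM dL degY in simp)+
      moreover from this have "degree (a * Y * N) \<le> q + 4" "degree (b * M * Y) \<le> q + 4"
        by (rule_tac [!] dm) (use dN degY in auto)
      ultimately have "degree (L * b - a * Y * N + b * M * Y) \<le> q + 4"
        by (intro degree_add_le degree_diff_le) auto
      then show ?thesis
        using dD[of q] by (intro dm) simp
    qed
    have t4: "degree ((a + b * Y) * (L * N * lucas_diff M (L * N) (q - 1))) \<le> 3 * q + 6"
    proof -
      have "degree (b * Y) \<le> q + 2"
        by (rule dm) (use db degY in simp)
      then have "degree (a + b * Y) \<le> q + 2"
        using da by (intro degree_add_le) auto
      moreover have "degree (L * N * lucas_diff M (L * N) (q - 1)) \<le> 2 * q + 3"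
        using dP dD[of "q - 1"] q by (intro dm) simp
      ultimately show ?thesis
        by (intro dm) simp
    qed
    show ?thesis
      unfolding W_def by (intro degree_add_le degree_diff_le t1 t2 t3 t4)
  qed
  have "card {y. poly h y = 0} = 2 * q + 2"
    using card_roots_eq_degree[OF h0] root degh by simp
  then have "2 * (2 * q + 2) \<le> degree W"
    using double_roots_le_degree[OF W0, of "{y. poly h y = 0}"] root by auto
  with degW q show False
    by simp
qed

section \<open>The Frobenius map on the algebraic closure of a finite field\<close>

lemma power_CARD_eq_self: "x ^ CARD('a) = x" for x :: "'a::{field,finite}"
proof (cases "x = 0")
  case False
  have "(\<Prod>y\<in>UNIV - {0}. y) = (\<Prod>y\<in>UNIV - {0}. x * y)"
    by (rule prod.reindex_bij_witness[of _ "\<lambda>y. x * y" "\<lambda>y. y / x"]) (use False in auto)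
  also have "\<dots> = x ^ (CARD('a) - 1) * (\<Prod>y\<in>UNIV - {0}. y)"
    by (simp add: prod.distrib)
  finally have "x ^ (CARD('a) - 1) = 1"
    by simp
  moreover have "x ^ CARD('a) = x * x ^ (CARD('a) - 1)"
    by (cases "CARD('a)") simp_all
  ultimately show ?thesis
    by simp
qed (simp add: power_0_left)

lemma CARD_field_ge_2: "2 \<le> CARD('a::{field,finite})"
proof -
  have "card {0, 1 :: 'a} \<le> CARD('a)"
    by (intro card_mono) auto
  then show ?thesis
    by simp
qed

text \<open>The polynomial (1 + X)^q - X^q - 1 has degree below q and vanishes at all q field
  elements, so it is zero. Its inner coefficients are the binomial coefficients.\<close>

lemma of_nat_CARD_choose_eq_0:
  assumes "0 < i" "i < CARD('a)"
  shows "of_nat (CARD('a) choose i) = (0 :: 'a::{field,finite})"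
proof -
  let ?q = "CARD('a)"
  define p where "p = [:1, 1 :: 'a:] ^ ?q - monom 1 ?q - 1"
  have "degree p < ?q"
  proof -
    have "degree p \<le> ?q"
      unfolding p_def
      by (intro degree_diff_le) (auto simp: degree_power_eq degree_monom_eq)
    moreover have "coeff p ?q = 0"
      by (simp add: p_def coeff_linear_power)
    ultimately show ?thesis
      using CARD_field_ge_2[where 'a = 'a]
      by (metis coeff_0 degree_0 le_neq_implies_less leading_coeff_0_iff not_numeral_le_zero)
  qed
  moreover have "poly p x = 0" for x
    by (simp add: p_def poly_monom power_CARD_eq_self)
  ultimately have "p = 0"
    using card_poly_roots_bound[of p] by (cases "p = 0") auto
  then have "coeff p i = 0"
    by simp
  then show ?thesis
    using assms by (simp add: p_def coeff_linear_poly_power)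
qed

definition frob :: "'a::{field,finite} alg_closure \<Rightarrow> 'a alg_closure" where
  "frob x = x ^ CARD('a)"

lemma of_nat_CARD_eq_0: "of_nat CARD('a) = (0 :: 'a::{field,finite} alg_closure)"
proof -
  have "of_nat (CARD('a) choose 1) = (0 :: 'a)"
    using CARD_field_ge_2[where 'a = 'a] by (intro of_nat_CARD_choose_eq_0) auto
  then have "to_ac (of_nat CARD('a) :: 'a) = 0"
    by simp
  then show ?thesis
    by simp
qed

lemma frob_add [simp]: "frob (x + y) = frob x + frob y"
  for x y :: "'a::{field,finite} alg_closure"
proof -
  let ?q = "CARD('a)"
  have 0: "of_nat (?q choose k) = (0 :: 'a alg_closure)" if "0 < k" "k < ?q" for k
    using of_nat_CARD_choose_eq_0[where 'a = 'a, OF that] by (metis to_ac_0 to_ac_of_nat)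
  have "(x + y) ^ ?q = (\<Sum>k\<le>?q. of_nat (?q choose k) * x ^ k * y ^ (?q - k))"
    by (rule binomial_ring)
  also have "\<dots> = (\<Sum>k\<in>{0, ?q}. of_nat (?q choose k) * x ^ k * y ^ (?q - k))"
    by (rule sum.mono_neutral_right) (auto simp: 0)
  also have "\<dots> = x ^ ?q + y ^ ?q"
    by (simp add: add.commute)
  finally show ?thesis
    by (simp add: frob_def)
qed

lemma frob_0 [simp]: "frob 0 = 0" and frob_1 [simp]: "frob 1 = 1"
  and frob_mult [simp]: "frob (x * y) = frob x * frob y"
  and frob_divide [simp]: "frob (x / y) = frob x / frob y"
  and frob_power [simp]: "frob (x ^ n) = frob x ^ n"
  by (simp_all add: frob_def power_0_left power_mult_distrib power_divide flip: power_mult)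
    (simp add: mult.commute)

lemma frob_diff [simp]: "frob (x - y) = frob x - frob y"
  using frob_add[of "x - y" y] by (simp add: algebra_simps del: frob_add)

lemma frob_minus [simp]: "frob (- x) = - frob x"
  using frob_diff[of 0 x] by (simp del: frob_diff)

lemma frob_eq_0_iff [simp]: "frob x = 0 \<longleftrightarrow> x = 0"
  by (simp add: frob_def)

lemma frob_eq_iff [simp]: "frob x = frob y \<longleftrightarrow> x = y"
  using frob_eq_0_iff[of "x - y"] by (simp del: frob_eq_0_iff)

lemma frob_to_ac [simp]: "frob (to_ac x) = to_ac x"
  by (simp add: frob_def power_CARD_eq_self flip: to_ac_power)

lemma frob_numeral [simp]: "frob (numeral n) = numeral n"
  using frob_to_ac[of "numeral n"] by simp

lemma frob_sum [simp]: "frob (\<Sum>i\<in>A. f i) = (\<Sum>i\<in>A. frob (f i))"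
  by (induction A rule: infinite_finite_induct) auto

text \<open>X^q - X has at most q roots, and the ground field already supplies q of them.\<close>

lemma frob_fixed_iff: "frob x = x \<longleftrightarrow> x \<in> range to_ac"
  for x :: "'a::{field,finite} alg_closure"
proof
  let ?q = "CARD('a)"
  define p where "p = monom 1 ?q - [:0, 1 :: 'a alg_closure:]"
  have deg: "degree p = ?q"
    unfolding p_def using CARD_field_ge_2[where 'a = 'a]
    by (subst diff_conv_add_uminus, subst degree_add_eq_left) (auto simp: degree_monom_eq)
  then have "p \<noteq> 0"
    using CARD_field_ge_2[where 'a = 'a] by auto
  have "range to_ac \<subseteq> {x. poly p x = 0}"
    using frob_to_ac by (auto simp: p_def poly_monom frob_def)
  moreover have "card {x. poly p x = 0} \<le> card (range (to_ac :: 'a \<Rightarrow> _))"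
    using card_poly_roots_bound[OF \<open>p \<noteq> 0\<close>] deg by (simp add: card_image inj_to_ac)
  ultimately have "range to_ac = {x. poly p x = 0}"
    using poly_roots_finite[OF \<open>p \<noteq> 0\<close>] by (intro card_seteq) auto
  moreover assume "frob x = x"
  ultimately show "x \<in> range to_ac"
    by (simp add: p_def poly_monom frob_def)
qed auto

lemma frob3_eq: "frob (frob (frob x)) = x ^ CARD('a) ^ 3"
  for x :: "'a::{field,finite} alg_closure"
  by (simp add: frob_def power3_eq_cube flip: power_mult)

lemma frob2_eq: "frob (frob x) = x ^ (CARD('a))\<^sup>2"
  for x :: "'a::{field,finite} alg_closure"
  by (simp add: frob_def power2_eq_square flip: power_mult)

text \<open>X^(q^3) - X has derivative -1 and hence only simple roots. The cubic extension field is
  represented throughout by this set of fixed points.\<close>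

lemma card_frob3_fixed: "card {x :: 'a::{field,finite} alg_closure. frob (frob (frob x)) = x} = CARD('a) ^ 3"
proof -
  let ?n = "CARD('a) ^ 3"
  have n: "1 < ?n"
    using CARD_field_ge_2[where 'a = 'a] by (intro one_less_power) auto
  define p where "p = monom 1 ?n - [:0, 1 :: 'a alg_closure:]"
  have deg: "degree p = ?n"
    unfolding p_def using n
    by (subst diff_conv_add_uminus, subst degree_add_eq_left) (auto simp: degree_monom_eq)
  have "poly (pderiv p) x = -1" for x
    by (simp add: p_def pderiv_diff pderiv_monom pderiv_pCons of_nat_CARD_eq_0 poly_monom)
  then have "card {x. poly p x = 0} = degree p"
    using deg n by (intro card_roots_eq_degree) auto
  then show ?thesis
    by (simp add: deg frob3_eq) (simp add: p_def poly_monom)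
qed

lemma exists_frob3_fixed:
  obtains t :: "'a::{field,finite} alg_closure" where "frob (frob (frob t)) = t" "frob t \<noteq> t"
proof -
  have "\<not> {x. frob (frob (frob x)) = x} \<subseteq> range (to_ac :: 'a \<Rightarrow> _)"
  proof
    assume "{x. frob (frob (frob x)) = x} \<subseteq> range (to_ac :: 'a \<Rightarrow> _)"
    then have "card {x :: 'a alg_closure. frob (frob (frob x)) = x} \<le> card (range (to_ac :: 'a \<Rightarrow> _))"
      by (intro card_mono) auto
    then have "CARD('a) ^ 3 \<le> CARD('a)"
      by (simp add: card_frob3_fixed card_image inj_to_ac)
    then show False
      using CARD_field_ge_2[where 'a = 'a] power_strict_increasing[of 1 3 "CARD('a)"] by simp
  qed
  then show ?thesis
    using that frob_fixed_iff by blast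
qed

text \<open>This is the equation Tr v * Tr (c / v) = m of the cubic field, multiplied by the norm of
  \<open>v\<close>.\<close>

lemma frob3_fixed_trace_product:
  fixes c m :: "'a::{field,finite} alg_closure"
  assumes "2 < CARD('a)" "frob (frob (frob c)) = c" "c \<noteq> 0" "frob m = m"
    and "\<not> (frob c = c \<and> m = c)"
  shows "\<exists>v. v \<noteq> 0 \<and> frob (frob (frob v)) = v \<and>
    (v + frob v + frob (frob v)) *
      (c * frob v * frob (frob v) + frob c * frob (frob v) * v + frob (frob c) * v * frob v) =
    m * v * frob v * frob (frob v)"
proof -
  let ?q = "CARD('a)"
  have pow: "v ^ ?q = frob v" "v ^ ?q\<^sup>2 = frob (frob v)" "v ^ ?q ^ 3 = frob (frob (frob v))"
    for v :: "'a alg_closure"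
    by (rule frob_def[symmetric] frob2_eq[symmetric] frob3_eq[symmetric])+
  have "(x + y) ^ ?q = x ^ ?q + y ^ ?q" for x y :: "'a alg_closure"
    by (simp add: pow)
  from cubic_curve_has_frobenius_fixed_point[OF this of_nat_CARD_eq_0 assms(1), of c "frob c" "frob (frob c)" m]
  have "\<lbrakk>frob c = frob c; frob (frob c) = frob (frob c); frob (frob (frob c)) = c; c \<noteq> 0; frob m = m;
      \<not> (c = frob c \<and> m = c)\<rbrakk> \<Longrightarrow> ?thesis"
    unfolding pow .
  then show ?thesis
    using assms(2-) by auto
qed

text \<open>For even q, -1 = frob (-1) = (-1)^q = 1. Conversely, if 2 = 0, an odd q would be 1 in
  the field, whereas q is 0 there.\<close>

lemma CARD_even_iff: "even CARD('a::{field,finite}) \<longleftrightarrow> (2 :: 'a alg_closure) = 0"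
proof
  assume "even CARD('a)"
  then have "frob (-1) = (1 :: 'a alg_closure)"
    by (simp add: frob_def)
  then show "(2 :: 'a alg_closure) = 0"
    by (simp add: eq_neg_iff_add_eq_0)
next
  assume 2: "(2 :: 'a alg_closure) = 0"
  show "even CARD('a)"
  proof (rule ccontr)
    assume "odd CARD('a)"
    then obtain k where "CARD('a) = 2 * k + 1"
      by (rule oddE)
    then have "of_nat CARD('a) = (1 :: 'a alg_closure)"
      using 2 by simp
    then show False
      by (simp add: of_nat_CARD_eq_0)
  qed
qed

section \<open>Sizes of matrix spaces and matrices of full rank\<close>

lemma card_mat_subspace:
  fixes S :: "('a::{field,finite}^'n^'m) set"
  assumes "matvs.subspace S"
  shows "card S = CARD('a) ^ matvs.dim S"
proof -
  obtain B where B: "B \<subseteq> S" "matvs.independent B" "S \<subseteq> matvs.span B" "card B = matvs.dim S"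
    using matvs.basis_exists by blast
  have fin: "finite B"
    by simp
  have S: "matvs.span B = S"
    using B assms matvs.span_minimal by blast
  let ?f = "\<lambda>u. \<Sum>v\<in>B. mat_scale (u v) v"
  have "inj_on ?f (B \<rightarrow>\<^sub>E UNIV)"
  proof (rule inj_onI)
    fix u w assume u: "u \<in> B \<rightarrow>\<^sub>E (UNIV :: 'a set)" and w: "w \<in> B \<rightarrow>\<^sub>E UNIV" and eq: "?f u = ?f w"
    have "(\<Sum>v\<in>B. mat_scale (u v - w v) v) = 0"
      using eq by (simp add: matvs.scale_left_diff_distrib sum_subtractf)
    then have "u v - w v = 0" if "v \<in> B" for v
      using matvs.independentD[OF B(2) fin subset_refl, of "\<lambda>v. u v - w v"] that by blast
    then show "u = w"
      using u w by (intro PiE_ext) auto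
  qed
  moreover have im: "?f ` (B \<rightarrow>\<^sub>E UNIV) = S"
  proof -
    have "?f u \<in> ?f ` (B \<rightarrow>\<^sub>E UNIV)" for u
      by (rule image_eqI[of _ _ "restrict u B"]) auto
    then show ?thesis
      unfolding S[symmetric] matvs.span_finite[OF fin] by auto
  qed
  ultimately have "card S = card (B \<rightarrow>\<^sub>E (UNIV :: 'a set))"
    unfolding im[symmetric] by (intro card_image)
  then show ?thesis
    by (simp add: card_PiE fin B(4))
qed

lemma rank_eq_3_iff: "rank A = 3 \<longleftrightarrow> det A \<noteq> 0" for A :: "'a::field^3^3"
proof -
  have "rank A = 3 \<longleftrightarrow> vec.span (rows A) = UNIV"
    unfolding row_rank_def_gen vec.dim_eq_full[symmetric] by (simp add: vec.dimension_def card_cart_basis)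
  also have "\<dots> \<longleftrightarrow> (\<exists>B. B ** A = mat 1)"
    by (simp only: matrix_left_invertible_span_rows_gen)
  also have "\<dots> \<longleftrightarrow> invertible A"
    by (simp only: invertible_left_inverse)
  finally show ?thesis
    by (simp only: invertible_det_nz)
qed

section \<open>Frobenius frames and Gram matrices\<close>

abbreviation lift_mat :: "'a::field^'n^'m \<Rightarrow> 'a alg_closure^'n^'m" where
  "lift_mat \<equiv> map_matrix to_ac"

abbreviation frob_mat :: "'a::{field,finite} alg_closure^'n^'m \<Rightarrow> 'a alg_closure^'n^'m" where
  "frob_mat \<equiv> map_matrix frob"

lemma lift_mat_mult: "lift_mat (A ** B) = lift_mat A ** lift_mat B"
  by (simp add: vec_eq_iff matrix_matrix_mult_def to_ac_sum)

lemma lift_mat_1 [simp]: "lift_mat (mat 1) = mat 1"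
  by (simp add: vec_eq_iff mat_def)

lemma transpose_map_matrix: "transpose (map_matrix f A) = map_matrix f (transpose A)"
  by (simp add: vec_eq_iff transpose_def)

lemma lift_mat_eq_iff [simp]: "lift_mat A = lift_mat B \<longleftrightarrow> A = B"
  by (simp add: vec_eq_iff)

lemma lift_mat_eq_0_iff [simp]: "lift_mat A = 0 \<longleftrightarrow> A = 0"
  by (simp add: vec_eq_iff)

lemma det_lift_mat: "det (lift_mat A) = to_ac (det A)" for A :: "'a::field^3^3"
  by (simp add: det_3)

lemma frob_mat_mult: "frob_mat (A ** B) = frob_mat A ** frob_mat B"
  by (simp add: vec_eq_iff matrix_matrix_mult_def)

lemma frob_mat_1 [simp]: "frob_mat (mat 1) = mat 1"
  by (simp add: vec_eq_iff mat_def)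

lemma frob_mat_lift_mat [simp]: "frob_mat (lift_mat A) = lift_mat A"
  by (simp add: vec_eq_iff)

lemma frob_mat_fixed_imp_lift_mat:
  assumes "frob_mat A = A"
  obtains B where "A = lift_mat B"
proof
  have "A $ i $ j \<in> range to_ac" for i j
    using assms by (simp add: vec_eq_iff flip: frob_fixed_iff)
  then show "A = lift_mat (map_matrix of_ac A)"
    by (simp add: vec_eq_iff to_ac_of_ac)
qed

text \<open>Right multiplication by this permutation matrix shifts the columns cyclically, so
  \<open>frob_mat P = P ** cyc\<close> says that Frobenius maps each column of \<open>P\<close> to
  the next.\<close>

definition cyc :: "'k::comm_ring_1^3^3" where
  "cyc = vector [vector [0, 0, 1], vector [1, 0, 0], vector [0, 1, 0]]"

lemma mult_cyc: "(A ** cyc) $ i $ 1 = A $ i $ 2" "(A ** cyc) $ i $ 2 = A $ i $ 3"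
    "(A ** cyc) $ i $ 3 = A $ i $ 1"
  and transpose_cyc_mult: "(transpose cyc ** A) $ 1 $ i = A $ 2 $ i"
    "(transpose cyc ** A) $ 2 $ i = A $ 3 $ i" "(transpose cyc ** A) $ 3 $ i = A $ 1 $ i"
  by (simp_all add: matrix_matrix_mult_def sum_3 cyc_def transpose_def)

lemma cyc_orthogonal: "cyc ** transpose cyc = mat 1" "transpose cyc ** cyc = mat 1"
  by (simp_all add: vec_eq_iff forall_3 matrix_matrix_mult_def sum_3 cyc_def transpose_def mat_def)

text \<open>The columns of a frame are the Frobenius conjugates of a basis of the cubic extension field.\<close>

definition frob_frame :: "'a::{field,finite} alg_closure^3^3 \<Rightarrow> bool" where
  "frob_frame P \<longleftrightarrow> invertible P \<and> frob_mat P = P ** cyc"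

text \<open>What being defined over the ground field becomes in the basis given by a frame:
  Frobenius shifts both indices of the matrix.\<close>

definition twisted :: "'a::{field,finite} alg_closure^3^3 \<Rightarrow> bool" where
  "twisted H \<longleftrightarrow> frob_mat H = transpose cyc ** H ** cyc"

lemma frob_frame_iff:
  "frob_frame P \<longleftrightarrow> invertible P \<and>
    (\<forall>i. frob (P $ i $ 1) = P $ i $ 2 \<and> frob (P $ i $ 2) = P $ i $ 3 \<and> frob (P $ i $ 3) = P $ i $ 1)"
  by (auto simp: frob_frame_def vec_eq_iff forall_3 mult_cyc)

lemma twisted_iff:
  "twisted H \<longleftrightarrow>
    frob (H $ 1 $ 1) = H $ 2 $ 2 \<and> frob (H $ 2 $ 2) = H $ 3 $ 3 \<and> frob (H $ 3 $ 3) = H $ 1 $ 1 \<and>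
    frob (H $ 1 $ 2) = H $ 2 $ 3 \<and> frob (H $ 2 $ 3) = H $ 3 $ 1 \<and> frob (H $ 3 $ 1) = H $ 1 $ 2 \<and>
    frob (H $ 2 $ 1) = H $ 3 $ 2 \<and> frob (H $ 3 $ 2) = H $ 1 $ 3 \<and> frob (H $ 1 $ 3) = H $ 2 $ 1"
  unfolding twisted_def vec_eq_iff forall_3 mult_cyc transpose_cyc_mult nth_map_matrix
  by (rule iffI; elim conjE; intro conjI; assumption)

lemma frob_frame_mult_twisted:
  assumes "frob_frame P" "twisted H" "invertible H"
  shows "frob_frame (P ** H)"
proof -
  have "frob_mat (P ** H) = P ** (cyc ** transpose cyc) ** H ** cyc"
    using assms unfolding frob_frame_def twisted_def by (simp only: frob_mat_mult matrix_mul_assoc)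
  then show ?thesis
    using assms by (simp add: frob_frame_def cyc_orthogonal invertible_mult)
qed

lemma frob_frame_inverse:
  assumes "frob_frame P"
  obtains Q where "P ** Q = mat 1" "Q ** P = mat 1" "frob_mat Q = transpose cyc ** Q"
proof -
  obtain Q where Q: "P ** Q = mat 1" "Q ** P = mat 1"
    using assms unfolding frob_frame_def invertible_def by blast
  have "frob_mat P ** frob_mat Q = mat 1"
    by (simp flip: frob_mat_mult add: Q)
  then have "P ** cyc ** frob_mat Q = mat 1"
    using assms by (simp add: frob_frame_def)
  then have "transpose cyc ** (Q ** P) ** cyc ** frob_mat Q = transpose cyc ** Q"
    by (metis matrix_mul_assoc matrix_mul_rid)
  then have "frob_mat Q = transpose cyc ** Q"
    by (simp add: Q cyc_orthogonal)
  with Q that show ?thesis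
    by blast
qed

text \<open>In the quotient of two frames the two shifts by \<open>cyc\<close> cancel, so it is
  fixed by Frobenius and has entries in the ground field.\<close>

lemma frob_frames_related:
  assumes "frob_frame P" "frob_frame Q"
  obtains A where "invertible A" "P = lift_mat A ** Q"
proof -
  obtain R where R: "Q ** R = mat 1" "R ** Q = mat 1" "frob_mat R = transpose cyc ** R"
    using frob_frame_inverse[OF assms(2)] .
  have "frob_mat (P ** R) = P ** (cyc ** transpose cyc) ** R"
    using assms(1) R(3) by (simp only: frob_mat_mult frob_frame_def matrix_mul_assoc)
  then have "frob_mat (P ** R) = P ** R"
    by (simp add: cyc_orthogonal)
  then obtain A where A: "P ** R = lift_mat A"
    using frob_mat_fixed_imp_lift_mat by blast
  have "invertible R"
    using R unfolding invertible_def by blast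
  then have "invertible (lift_mat A)"
    using assms(1) invertible_mult A unfolding frob_frame_def by metis
  then have "invertible A"
    by (simp add: invertible_det_nz det_lift_mat)
  moreover have "P = lift_mat A ** Q"
    unfolding A[symmetric] by (simp add: R flip: matrix_mul_assoc)
  ultimately show ?thesis
    using that by blast
qed

section \<open>Gram matrices in a frame\<close>

definition gram :: "'a::field alg_closure^3^3 \<Rightarrow> 'a^3^3 \<Rightarrow> 'a alg_closure^3^3" where
  "gram P M = transpose P ** lift_mat M ** P"

lemma gram_nth: "gram P M $ i $ j = (\<Sum>k\<in>UNIV. \<Sum>l\<in>UNIV. P $ l $ i * to_ac (M $ l $ k) * P $ k $ j)"
  by (simp add: gram_def matrix_matrix_mult_def transpose_def sum_distrib_right)

lemma gram_add: "gram P (M + N) $ i $ j = gram P M $ i $ j + gram P N $ i $ j"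
  and gram_diff: "gram P (M - N) $ i $ j = gram P M $ i $ j - gram P N $ i $ j"
  and gram_scale: "gram P (mat_scale c M) $ i $ j = to_ac c * gram P M $ i $ j"
  and gram_0: "gram P 0 $ i $ j = 0"
  by (simp_all add: gram_nth mat_scale_def sum_3 algebra_simps)

lemma transpose_gram: "transpose M = M \<Longrightarrow> transpose (gram P M) = gram P M"
  by (simp add: gram_def matrix_transpose_mul transpose_map_matrix matrix_mul_assoc)

lemma twisted_gram: "frob_frame P \<Longrightarrow> twisted (gram P M)"
  by (simp add: gram_def twisted_def frob_frame_def frob_mat_mult matrix_transpose_mul matrix_mul_assoc
      flip: transpose_map_matrix)

lemma det_gram: "det (gram P M) = (det P)\<^sup>2 * to_ac (det M)"
  by (simp add: gram_def det_mul det_lift_mat power2_eq_square)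

lemma gram_eq_0_imp:
  assumes "frob_frame P" "gram P M = 0"
  shows "M = 0"
proof -
  obtain Q where Q: "P ** Q = mat 1" "Q ** P = mat 1"
    using frob_frame_inverse[OF assms(1)] by metis
  have "lift_mat M = transpose (P ** Q) ** lift_mat M ** (P ** Q)"
    by (simp add: Q)
  also have "\<dots> = transpose Q ** gram P M ** Q"
    by (simp add: gram_def matrix_transpose_mul matrix_mul_assoc)
  finally show ?thesis
    using assms(2) by simp
qed

text \<open>With \<open>a\<close> and \<open>b\<close> in the cubic field, this is the general
  symmetric twisted matrix.\<close>

definition hmat :: "'a::{field,finite} alg_closure \<Rightarrow> 'a alg_closure \<Rightarrow> 'a alg_closure^3^3" where
  "hmat a b = vector [vector [a, b, frob (frob b)], vector [b, frob a, frob b],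
     vector [frob (frob b), frob b, frob (frob a)]]"

lemma hmat_nth [simp]:
  "hmat a b $ 1 $ 1 = a" "hmat a b $ 1 $ 2 = b" "hmat a b $ 1 $ 3 = frob (frob b)"
  "hmat a b $ 2 $ 1 = b" "hmat a b $ 2 $ 2 = frob a" "hmat a b $ 2 $ 3 = frob b"
  "hmat a b $ 3 $ 1 = frob (frob b)" "hmat a b $ 3 $ 2 = frob b" "hmat a b $ 3 $ 3 = frob (frob a)"
  by (simp_all add: hmat_def)

lemma det_hmat: "det (hmat a b) = a * frob a * frob (frob a) + 2 * b * frob b * frob (frob b)
    - a * (frob b)\<^sup>2 - frob a * (frob (frob b))\<^sup>2 - frob (frob a) * b\<^sup>2"
  by (simp add: det_3 power2_eq_square algebra_simps)

lemma gram_eq_hmat: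
  assumes "frob_frame P" "transpose M = M"
  defines "a \<equiv> gram P M $ 1 $ 1" and "b \<equiv> gram P M $ 1 $ 2"
  shows "gram P M = hmat a b" "frob (frob (frob a)) = a" "frob (frob (frob b)) = b"
proof -
  have t: "twisted (gram P M)"
    using assms by (intro twisted_gram)
  have s: "gram P M $ i $ j = gram P M $ j $ i" for i j
    using transpose_gram[OF assms(2), of P] by (simp add: vec_eq_iff transpose_def)
  show "gram P M = hmat a b" "frob (frob (frob a)) = a" "frob (frob (frob b)) = b"
    using t s[of 1 2] s[of 1 3] s[of 2 3] unfolding twisted_iff a_def b_def
    by (auto simp: vec_eq_iff forall_3)
qed

text \<open>Congruence by the inverse of the frame turns a twisted matrix into one fixed by
  Frobenius, hence into a matrix over the ground field.\<close>

lemma exists_gram_eq_hmat: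
  assumes "frob_frame P" "frob (frob (frob a)) = a" "frob (frob (frob b)) = b"
  obtains M where "transpose M = M" "gram P M = hmat a b"
proof -
  obtain Q where Q: "P ** Q = mat 1" "Q ** P = mat 1" "frob_mat Q = transpose cyc ** Q"
    using frob_frame_inverse[OF assms(1)] .
  define Z where "Z = transpose Q ** hmat a b ** Q"
  have "twisted (hmat a b)"
    using assms by (simp add: twisted_iff)
  then have "frob_mat Z = transpose Q ** (cyc ** transpose cyc) ** hmat a b ** (cyc ** transpose cyc) ** Q"
    unfolding Z_def frob_mat_mult transpose_map_matrix[symmetric] Q(3) twisted_def
    by (simp add: matrix_transpose_mul matrix_mul_assoc)
  then have "frob_mat Z = Z"
    by (simp add: cyc_orthogonal Z_def)
  then obtain M where M: "Z = lift_mat M"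
    by (rule frob_mat_fixed_imp_lift_mat)
  have "transpose (hmat a b) = hmat a b"
    by (simp add: vec_eq_iff forall_3 transpose_def)
  then have "transpose Z = Z"
    by (simp add: Z_def matrix_transpose_mul matrix_mul_assoc)
  then have "transpose M = M"
    by (simp add: M transpose_map_matrix)
  moreover have "gram P M = transpose (Q ** P) ** hmat a b ** (Q ** P)"
    by (simp add: gram_def M[symmetric] Z_def matrix_transpose_mul matrix_mul_assoc)
  ultimately show ?thesis
    using that by (simp add: Q)
qed

lemma exists_frob_frame: "\<exists>P :: 'a::{field,finite} alg_closure^3^3. frob_frame P"
proof -
  obtain t :: "'a alg_closure" where t: "frob (frob (frob t)) = t" "frob t \<noteq> t"
    by (rule exists_frob3_fixed)
  have ne: "frob (frob t) \<noteq> t" "frob (frob t) \<noteq> frob t"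
    using t frob_eq_iff by metis+
  \<comment> \<open>The Vandermonde matrix of the three distinct conjugates of
    \<open>t\<close>.\<close>
  let ?P = "vector [vector [1, 1, 1], vector [t, frob t, frob (frob t)],
    vector [t\<^sup>2, (frob t)\<^sup>2, (frob (frob t))\<^sup>2]] :: 'a alg_closure^3^3"
  have "det ?P = (frob t - t) * (frob (frob t) - t) * (frob (frob t) - frob t)"
    by (simp add: det_3 power2_eq_square algebra_simps)
  then have "invertible ?P"
    using t ne by (simp add: invertible_det_nz)
  then have "frob_frame ?P"
    unfolding frob_frame_iff using t by (auto simp: forall_3)
  then show ?thesis ..
qed

section \<open>Field codes and twisted field codes\<close>

text \<open>The conditions of \<open>perfect_msrd_codes\<close> without the dimension, with rank 3
  expressed by the determinant. Perfect codes are those of the largest possible size, q^3.\<close>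

definition nonsingular_code :: "('a::field^3^3) set \<Rightarrow> bool" where
  "nonsingular_code C \<longleftrightarrow> linear_srd_code C \<and> (\<forall>M\<in>C. M \<noteq> 0 \<longrightarrow> det M \<noteq> 0)"

lemma nonsingular_codeD:
  assumes "nonsingular_code C"
  shows "matvs.subspace C" "M \<in> C \<Longrightarrow> transpose M = M" "M \<in> C \<Longrightarrow> M \<noteq> 0 \<Longrightarrow> det M \<noteq> 0"
  using assms by (auto simp: nonsingular_code_def linear_srd_code_def)

text \<open>Two codewords with the same first row differ by a matrix with a zero row, which is
  singular. So the first row determines the codeword.\<close>

lemma card_nonsingular_code_le:
  fixes C :: "('a::{field,finite}^3^3) set"
  assumes "nonsingular_code C"
  shows "card C \<le> CARD('a) ^ 3"
proof -
  have "inj_on (\<lambda>M. M $ 1) C"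
  proof (rule inj_onI)
    fix M N assume MN: "M \<in> C" "N \<in> C" "M $ 1 = N $ 1"
    have "M - N \<in> C"
      using MN assms by (simp add: nonsingular_codeD matvs.subspace_diff)
    moreover have "det (M - N) = 0"
      using MN(3) by (simp add: det_3)
    ultimately show "M = N"
      using nonsingular_codeD(3)[OF assms] by force
  qed
  then have "card C \<le> CARD('a^3)"
    by (rule card_inj_on_le) auto
  then show ?thesis
    by simp
qed

lemma perfect_msrd_codes_iff:
  fixes C :: "('a::{field,finite}^3^3) set"
  shows "C \<in> perfect_msrd_codes \<longleftrightarrow> nonsingular_code C \<and> card C = CARD('a) ^ 3"
proof -
  have "matvs.dim C = 3 \<longleftrightarrow> card C = CARD('a) ^ 3" if "matvs.subspace C"
    using card_mat_subspace[OF that] CARD_field_ge_2[where 'a = 'a] by simp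
  then show ?thesis
    by (auto simp: perfect_msrd_codes_def nonsingular_code_def linear_srd_code_def rank_eq_3_iff)
qed

lemma perfect_msrd_code_eqI:
  fixes C D :: "('a::{field,finite}^3^3) set"
  assumes "C \<in> perfect_msrd_codes" "nonsingular_code D" "C \<subseteq> D"
  shows "C = D"
  using assms card_nonsingular_code_le[OF assms(2)] card_seteq[OF _ assms(3)]
  by (simp add: perfect_msrd_codes_iff)

definition field_code :: "'a::{field,finite} alg_closure^3^3 \<Rightarrow> ('a^3^3) set" where
  "field_code P = {M. transpose M = M \<and> gram P M $ 1 $ 2 = 0}"

text \<open>
  These are the codewords with Gram matrix \<open>hmat a b\<close>, \<open>b\<close> in the ground field and \<open>Tr a = 2 b\<close>; such a
  matrix has determinant \<open>N(a)\<close>.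
\<close>

definition twisted_field_code :: "'a::{field,finite} alg_closure^3^3 \<Rightarrow> ('a^3^3) set" where
  "twisted_field_code P = {M. transpose M = M \<and> frob (gram P M $ 1 $ 2) = gram P M $ 1 $ 2 \<and>
     gram P M $ 1 $ 1 + gram P M $ 2 $ 2 + gram P M $ 3 $ 3 = 2 * gram P M $ 1 $ 2}"

lemma transpose_add_mat: "transpose (M + N) = transpose M + transpose N"
  and transpose_mat_scale: "transpose (mat_scale c M) = mat_scale c (transpose M)"
  and transpose_0: "transpose 0 = 0"
  by (simp_all add: vec_eq_iff transpose_def mat_scale_def)

lemma det_neq_0_if_gram:
  assumes "det (gram P M) \<noteq> 0"
  shows "det M \<noteq> 0"
  using assms by (auto simp: det_gram)

text \<open>The determinant of a diagonal Gram matrix here is the norm of its first entry.\<close>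

lemma nonsingular_field_code:
  assumes P: "frob_frame P"
  shows "nonsingular_code (field_code P)"
proof -
  have "matvs.subspace (field_code P)"
    by (rule matvs.subspaceI)
      (auto simp: field_code_def transpose_add_mat transpose_mat_scale transpose_0 gram_add gram_scale gram_0)
  moreover have "det M \<noteq> 0" if M: "M \<in> field_code P" "M \<noteq> 0" for M
  proof -
    let ?a = "gram P M $ 1 $ 1"
    have h: "gram P M = hmat ?a 0"
      using gram_eq_hmat(1)[OF P, of M] M by (simp add: field_code_def)
    have "?a \<noteq> 0"
    proof
      assume "?a = 0"
      then have "gram P M = 0"
        using h by (simp add: vec_eq_iff forall_3)
      then show False
        using gram_eq_0_imp[OF P] M by blast
    qed
    then have "det (hmat ?a 0) \<noteq> 0"
      by (simp add: det_hmat)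
    then show ?thesis
      using det_neq_0_if_gram[of P M] h by metis
  qed
  ultimately show ?thesis
    by (auto simp: nonsingular_code_def linear_srd_code_def field_code_def)
qed

text \<open>The Gram determinant is N(a) + b^2 (2 b - Tr a) = N(a). As 2 is invertible, a = 0 forces
  b = 0 and so the zero codeword.\<close>

lemma nonsingular_twisted_field_code:
  fixes P :: "'a::{field,finite} alg_closure^3^3"
  assumes P: "frob_frame P" and 2: "(2 :: 'a alg_closure) \<noteq> 0"
  shows "nonsingular_code (twisted_field_code P)"
proof -
  have "matvs.subspace (twisted_field_code P)"
  proof (rule matvs.subspaceI)
    show "0 \<in> twisted_field_code P"
      by (simp add: twisted_field_code_def transpose_0 gram_0)
  next
    have sum: "(a + x) + (b + y) + (c + z) = 2 * (e + w)"
      if "a + b + c = 2 * e" "x + y + z = 2 * w" for a b c e x y z w :: "'a alg_closure"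
      using arg_cong2[OF that, of plus] by (simp only: distrib_left add_ac)
    fix M N assume "M \<in> twisted_field_code P" "N \<in> twisted_field_code P"
    then show "M + N \<in> twisted_field_code P"
      unfolding twisted_field_code_def mem_Collect_eq transpose_add_mat gram_add frob_add
      by (intro conjI sum) simp_all
  next
    have scale: "r * a + r * b + r * c = 2 * (r * e)"
      if "a + b + c = 2 * e" for a b c e r :: "'a alg_closure"
      using arg_cong[OF that, of "times r"] by (simp only: distrib_left mult_ac)
    fix c M assume "M \<in> twisted_field_code P"
    then show "mat_scale c M \<in> twisted_field_code P"
      unfolding twisted_field_code_def mem_Collect_eq transpose_mat_scale gram_scale frob_mult frob_to_ac
      by (intro conjI scale) simp_all
  qed
  moreover have "det M \<noteq> 0" if M: "M \<in> twisted_field_code P" "M \<noteq> 0" for M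
  proof -
    let ?a = "gram P M $ 1 $ 1" and ?b = "gram P M $ 1 $ 2"
    have h: "gram P M = hmat ?a ?b"
      using gram_eq_hmat(1)[OF P, of M] M by (simp add: twisted_field_code_def)
    have b: "frob ?b = ?b"
      using M by (simp add: twisted_field_code_def)
    have "hmat ?a ?b $ 1 $ 1 + hmat ?a ?b $ 2 $ 2 + hmat ?a ?b $ 3 $ 3 = 2 * ?b"
      using M unfolding twisted_field_code_def h[symmetric] by blast
    then have tr: "?a + frob ?a + frob (frob ?a) = 2 * ?b"
      by simp
    have "?a \<noteq> 0"
    proof
      assume a: "?a = 0"
      then have "?b = 0"
        using tr 2 by simp
      then have "gram P M = 0"
        using a h by (simp add: vec_eq_iff forall_3)
      then show False
        using gram_eq_0_imp[OF P] M by blast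
    qed
    moreover have "det (hmat ?a ?b) = ?a * frob ?a * frob (frob ?a)
        + ?b\<^sup>2 * (2 * ?b - (?a + frob ?a + frob (frob ?a)))"
      by (simp add: det_hmat b algebra_simps power2_eq_square)
    ultimately have "det (hmat ?a ?b) \<noteq> 0"
      unfolding tr by simp
    then show ?thesis
      using det_neq_0_if_gram[of P M] h by metis
  qed
  ultimately show ?thesis
    by (auto simp: nonsingular_code_def linear_srd_code_def twisted_field_code_def)
qed

lemma card_ge_if_gram_surj:
  fixes D :: "('a::{field,finite}^3^3) set"
  assumes "\<And>a. frob (frob (frob a)) = a \<Longrightarrow> \<exists>M\<in>D. gram P M $ 1 $ 1 = a"
  shows "CARD('a) ^ 3 \<le> card D"
proof -
  have "{a. frob (frob (frob a)) = a} \<subseteq> (\<lambda>M. gram P M $ 1 $ 1) ` D"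
    using assms by force
  then have "card {a :: 'a alg_closure. frob (frob (frob a)) = a} \<le> card ((\<lambda>M. gram P M $ 1 $ 1) ` D)"
    by (intro card_mono) auto
  also have "\<dots> \<le> card D"
    by (rule card_image_le) simp
  finally show ?thesis
    by (simp add: card_frob3_fixed)
qed

lemma field_code_perfect:
  assumes P: "frob_frame P"
  shows "field_code P \<in> perfect_msrd_codes"
proof -
  have "\<exists>M\<in>field_code P. gram P M $ 1 $ 1 = a" if a: "frob (frob (frob a)) = a" for a
  proof -
    obtain M where "transpose M = M" "gram P M = hmat a 0"
      using exists_gram_eq_hmat[OF P a, of 0] by auto
    then show ?thesis
      by (intro bexI[of _ M]) (simp_all add: field_code_def)
  qed
  then show ?thesis
    using card_ge_if_gram_surj[of "field_code P" P] nonsingular_field_code[OF P]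
      card_nonsingular_code_le[OF nonsingular_field_code[OF P]]
    by (simp add: perfect_msrd_codes_iff)
qed

lemma exists_in_twisted_field_code:
  fixes P :: "'a::{field,finite} alg_closure^3^3"
  assumes P: "frob_frame P" and 2: "(2 :: 'a alg_closure) \<noteq> 0" and a: "frob (frob (frob a)) = a"
  obtains M where "M \<in> twisted_field_code P" "gram P M = hmat a ((a + frob a + frob (frob a)) / 2)"
proof -
  let ?b = "(a + frob a + frob (frob a)) / 2"
  have b: "frob ?b = ?b"
    by (simp add: a add_ac)
  obtain M where M: "transpose M = M" "gram P M = hmat a ?b"
    using exists_gram_eq_hmat[OF P a, of ?b] b by metis
  have "M \<in> twisted_field_code P"
    unfolding twisted_field_code_def mem_Collect_eq M(2) hmat_nth using M(1) b 2 by simp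
  with M(2) that show ?thesis
    by blast
qed

lemma twisted_field_code_perfect:
  fixes P :: "'a::{field,finite} alg_closure^3^3"
  assumes P: "frob_frame P" and 2: "(2 :: 'a alg_closure) \<noteq> 0"
  shows "twisted_field_code P \<in> perfect_msrd_codes"
proof -
  have "\<exists>M\<in>twisted_field_code P. gram P M $ 1 $ 1 = a" if a: "frob (frob (frob a)) = a" for a
  proof -
    obtain M where "M \<in> twisted_field_code P" "gram P M = hmat a ((a + frob a + frob (frob a)) / 2)"
      using exists_in_twisted_field_code[OF P 2 a] .
    then show ?thesis
      by (intro bexI[of _ M]) simp_all
  qed
  then show ?thesis
    using card_ge_if_gram_surj[of "twisted_field_code P" P] nonsingular_twisted_field_code[OF P 2]
      card_nonsingular_code_le[OF nonsingular_twisted_field_code[OF P 2]]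
    by (simp add: perfect_msrd_codes_iff)
qed

section \<open>Independence of the frame\<close>

lemma gram_lift_mult: "gram (lift_mat A ** Q) M = gram Q (transpose A ** M ** A)"
  by (simp add: gram_def lift_mat_mult matrix_transpose_mul transpose_map_matrix matrix_mul_assoc)

text \<open>Two frames differ by an invertible matrix \<open>A\<close> over the ground field, and
  congruence by \<open>A\<close> preserves symmetry and translates one kind of Gram matrix into the
  other. The predicate is left open to cover both families of codes.\<close>

lemma code_equivalent_frames:
  fixes P Q :: "'a::{field,finite} alg_closure^3^3" and \<Phi> :: "'a alg_closure^3^3 \<Rightarrow> bool"
  assumes "frob_frame P" "frob_frame Q"
  shows "code_equivalent {M. transpose M = M \<and> \<Phi> (gram P M)} {M. transpose M = M \<and> \<Phi> (gram Q M)}"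
proof -
  obtain A where A: "invertible A" "P = lift_mat A ** Q"
    using frob_frames_related[OF assms] .
  obtain B where B: "A ** B = mat 1" "B ** A = mat 1"
    using A(1) unfolding invertible_def by blast
  have inv: "transpose A ** (transpose B ** M ** B) ** A = M" for M
  proof -
    have "transpose A ** (transpose B ** M ** B) ** A = transpose (B ** A) ** M ** (B ** A)"
      by (simp add: matrix_transpose_mul matrix_mul_assoc)
    then show ?thesis
      by (simp add: B)
  qed
  have "{M. transpose M = M \<and> \<Phi> (gram Q M)} =
      {transpose A ** M ** A | M. M \<in> {M. transpose M = M \<and> \<Phi> (gram P M)}}" (is "?L = ?R")
  proof (intro equalityI subsetI)
    fix M assume M: "M \<in> ?L"
    have "transpose (transpose B ** M ** B) = transpose B ** M ** B"
      using M by (simp add: matrix_transpose_mul matrix_mul_assoc)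
    moreover have "gram P (transpose B ** M ** B) = gram Q M"
      unfolding A(2) gram_lift_mult inv ..
    ultimately have "transpose B ** M ** B \<in> {M. transpose M = M \<and> \<Phi> (gram P M)}"
      using M by simp
    then show "M \<in> ?R"
      using inv[of M] by (metis (mono_tags, lifting) mem_Collect_eq)
  next
    fix M assume "M \<in> ?R"
    then show "M \<in> ?L"
      by (auto simp: A(2) gram_lift_mult matrix_transpose_mul matrix_mul_assoc)
  qed
  moreover have "invertible (transpose A)"
    using A(1) by (simp add: invertible_det_nz)
  ultimately show ?thesis
    using A(1) unfolding code_equivalent_def by blast
qed

lemma code_equivalent_field_code:
  "frob_frame P \<Longrightarrow> frob_frame Q \<Longrightarrow> code_equivalent (field_code P) (field_code Q)"
  unfolding field_code_def by (rule code_equivalent_frames[where \<Phi> = "\<lambda>H. H $ 1 $ 2 = 0"])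

lemma code_equivalent_twisted_field_code:
  "frob_frame P \<Longrightarrow> frob_frame Q \<Longrightarrow> code_equivalent (twisted_field_code P) (twisted_field_code Q)"
  unfolding twisted_field_code_def
  by (rule code_equivalent_frames[where \<Phi> = "\<lambda>H. frob (H $ 1 $ 2) = H $ 1 $ 2 \<and>
     H $ 1 $ 1 + H $ 2 $ 2 + H $ 3 $ 3 = 2 * H $ 1 $ 2"])

section \<open>Classification\<close>

lemma det_pencil:
  fixes A B :: "'a::field^3^3"
  obtains e1 e2 where "\<And>t. det (lift_mat A - mat_scale t (lift_mat B)) =
    to_ac (det A) + to_ac e1 * t + to_ac e2 * t\<^sup>2 - to_ac (det B) * t ^ 3"
proof
  \<comment> \<open>Expansion by rows: \<open>?D S\<close> is the determinant with the rows in
    \<open>S\<close> taken from \<open>B\<close>.\<close>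
  let ?D = "\<lambda>S. det (\<chi> i. if i \<in> S then B $ i else A $ i)"
  fix t
  show "det (lift_mat A - mat_scale t (lift_mat B)) = to_ac (det A)
      + to_ac (- (?D {1} + ?D {2} + ?D {3})) * t + to_ac (?D {1, 2} + ?D {1, 3} + ?D {2, 3}) * t\<^sup>2
      - to_ac (det B) * t ^ 3"
    by (simp add: det_3 mat_scale_def algebra_simps power2_eq_square power3_eq_cube)
qed

text \<open>Vieta's formulas. They serve to show that if Frobenius swaps two roots, the third root
  is fixed by it.\<close>

lemma cubic_third_root:
  fixes x y :: "'a::field"
  assumes "a3 \<noteq> 0" "x \<noteq> y" "a0 + a1 * x + a2 * x\<^sup>2 + a3 * x ^ 3 = 0" "a0 + a1 * y + a2 * y\<^sup>2 + a3 * y ^ 3 = 0"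
    and z: "z = - a2 / a3 - x - y"
  shows "a0 + a1 * z + a2 * z\<^sup>2 + a3 * z ^ 3 = 0"
proof -
  have a2: "a2 = - a3 * (x + y + z)"
    using assms(1) by (simp add: z)
  have "(x - y) * (a1 + a2 * (x + y) + a3 * (x\<^sup>2 + x * y + y\<^sup>2)) =
      (a0 + a1 * x + a2 * x\<^sup>2 + a3 * x ^ 3) - (a0 + a1 * y + a2 * y\<^sup>2 + a3 * y ^ 3)"
    by (simp add: algebra_simps power2_eq_square power3_eq_cube)
  then have "(x - y) * (a1 + a2 * (x + y) + a3 * (x\<^sup>2 + x * y + y\<^sup>2)) = 0"
    by (simp add: assms(3,4))
  then have "a1 + (a2 * (x + y) + a3 * (x\<^sup>2 + x * y + y\<^sup>2)) = 0"
    using assms(2) by (simp add: add.assoc)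
  then have "a1 = - (a2 * (x + y) + a3 * (x\<^sup>2 + x * y + y\<^sup>2))"
    by (simp only: eq_neg_iff_add_eq_0)
  then have a1: "a1 = a3 * (x * y + z * (x + y))"
    unfolding a2 by (simp add: algebra_simps power2_eq_square)
  have "a0 = - (a1 * x + a2 * x\<^sup>2 + a3 * x ^ 3)"
    using assms(3) by (simp add: algebra_simps eq_neg_iff_add_eq_0)
  then show ?thesis
    unfolding a1 a2 by (simp add: algebra_simps power2_eq_square power3_eq_cube)
qed

text \<open>The cubic det (A - t B) has no root in the ground field. A root of degree 2 would force
  a third root there by Vieta, and more than three conjugates would exceed the degree, so a root has
  exactly three conjugates.\<close>

lemma pencil_root:
  fixes A B :: "'a::{field,finite}^3^3"
  assumes "det B \<noteq> 0" and ns: "\<And>c. det (A - mat_scale c B) \<noteq> 0"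
  obtains t where "det (lift_mat A - mat_scale t (lift_mat B)) = 0" "frob (frob (frob t)) = t"
    "frob t \<noteq> t" "frob (frob t) \<noteq> t"
proof -
  obtain e1 e2 where e: "\<And>t. det (lift_mat A - mat_scale t (lift_mat B)) =
    to_ac (det A) + to_ac e1 * t + to_ac e2 * t\<^sup>2 - to_ac (det B) * t ^ 3"
    using det_pencil[of A B] by blast
  define p where "p = [:to_ac (det A), to_ac e1, to_ac e2, - to_ac (det B):]"
  have p: "poly p t = det (lift_mat A - mat_scale t (lift_mat B))" for t
    unfolding e p_def by (simp add: algebra_simps power2_eq_square power3_eq_cube)
  have deg: "degree p = 3"
    using assms(1) by (simp add: p_def)
  then obtain t where t: "poly p t = 0"
    using alg_closed_imp_poly_has_root[of p] by auto
  have frob_p: "poly p (frob t) = frob (poly p t)" for t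
    by (simp add: p_def)
  have notF: "frob s \<noteq> s" if "poly p s = 0" for s
  proof
    assume "frob s = s"
    then obtain c where "s = to_ac c"
      using frob_fixed_iff by blast
    moreover have "lift_mat A - mat_scale (to_ac c) (lift_mat B) = lift_mat (A - mat_scale c B)"
      by (simp add: vec_eq_iff mat_scale_def)
    ultimately show False
      using that ns[of c] by (simp add: p det_lift_mat)
  qed
  have t1: "frob t \<noteq> t"
    using notF t .
  have t2: "frob (frob t) \<noteq> t"
  proof
    assume *: "frob (frob t) = t"
    define z where "z = - to_ac e2 / - to_ac (det B) - t - frob t"
    have "to_ac (det A) + to_ac e1 * z + to_ac e2 * z\<^sup>2 + - to_ac (det B) * z ^ 3 = 0"
    proof (rule cubic_third_root[OF _ t1[symmetric] _ _ z_def])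
      show "to_ac (det A) + to_ac e1 * t + to_ac e2 * t\<^sup>2 + - to_ac (det B) * t ^ 3 = 0"
        using t e[of t] by (simp add: p)
      show "to_ac (det A) + to_ac e1 * frob t + to_ac e2 * (frob t)\<^sup>2 + - to_ac (det B) * frob t ^ 3 = 0"
        using frob_p[of t] t e[of "frob t"] by (simp add: p)
    qed (use assms(1) in simp)
    then have "poly p z = 0"
      using e[of z] by (simp add: p)
    moreover have "frob z = z"
      by (simp add: z_def *)
    ultimately show False
      using notF by blast
  qed
  have "frob (frob (frob t)) = t"
  proof (rule ccontr)
    assume t3: "frob (frob (frob t)) \<noteq> t"
    let ?S = "{t, frob t, frob (frob t), frob (frob (frob t))}"
    have "card ?S = 4"
      using t1 t2 t3 by (auto simp: card_insert_if)
    moreover have "?S \<subseteq> {x. poly p x = 0}"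
      using t by (simp add: frob_p)
    then have "card ?S \<le> card {x. poly p x = 0}"
      using deg by (intro card_mono poly_roots_finite) auto
    moreover have "card {x. poly p x = 0} \<le> 3"
      using card_poly_roots_bound[of p] deg by fastforce
    ultimately show False
      by simp
  qed
  with t t1 t2 that show ?thesis
    by (simp add: p)
qed

lemma vandermonde_3:
  fixes x y z :: "'a::field"
  assumes "x \<noteq> y" "x \<noteq> z" "y \<noteq> z" "u + v + w = 0" "u * x + v * y + w * z = 0"
    "u * x * x + v * y * y + w * z * z = 0"
  shows "u = 0" "v = 0" "w = 0"
proof -
  let ?s = "u + v + w" and ?t = "u * x + v * y + w * z" and ?r = "u * x * x + v * y * y + w * z * z"
  have "u * (x - y) * (x - z) = ?r - (y + z) * ?t + y * z * ?s"
    "v * (y - x) * (y - z) = ?r - (x + z) * ?t + x * z * ?s"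
    "w * (z - x) * (z - y) = ?r - (x + y) * ?t + x * y * ?s"
    by (simp_all add: algebra_simps)
  then have "u * (x - y) * (x - z) = 0" "v * (y - x) * (y - z) = 0" "w * (z - x) * (z - y) = 0"
    unfolding assms(4-6) by simp_all
  then show "u = 0" "v = 0" "w = 0"
    using assms(1-3) by simp_all
qed

text \<open>
  An eigenvector of a pencil of symmetric matrices and its conjugates form a frame that diagonalises
  the pencil.
\<close>

lemma exists_diagonalising_frame:
  fixes A B :: "'a::{field,finite}^3^3"
  assumes sym: "transpose A = A" "transpose B = B"
    and det: "det B \<noteq> 0" "\<And>c. det (A - mat_scale c B) \<noteq> 0"
  obtains P d t where "frob_frame P" "gram P B = hmat d 0" "gram P A = hmat (d * t) 0" "d \<noteq> 0"
    "frob (frob (frob t)) = t" "frob t \<noteq> t"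
proof -
  obtain t where t: "det (lift_mat A - mat_scale t (lift_mat B)) = 0" "frob (frob (frob t)) = t"
    "frob t \<noteq> t" "frob (frob t) \<noteq> t"
    using pencil_root[OF det] .
  let ?N = "lift_mat A - mat_scale t (lift_mat B)"
  have "\<not> (\<exists>B. B ** ?N = mat 1)"
    using t(1) by (simp add: invertible_det_nz flip: invertible_left_inverse)
  then obtain v0 where v0: "?N *v v0 = 0" "v0 \<noteq> 0"
    unfolding matrix_left_invertible_ker by blast
  obtain k where k: "v0 $ k \<noteq> 0"
    using v0(2) by (auto simp: vec_eq_iff)
  \<comment> \<open>The eigenvector is normalised to have coordinate 1 at \<open>k\<close>. This
    fixes its scale, so that its third conjugate can be shown to be itself.\<close>
  define v where "v i = v0 $ i / v0 $ k" for i
  have vk: "v k = 1"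
    using k by (simp add: v_def)
  have v: "(\<Sum>j\<in>UNIV. to_ac (A $ i $ j) * v j) = t * (\<Sum>j\<in>UNIV. to_ac (B $ i $ j) * v j)" for i
  proof -
    have "(?N *v v0) $ i / v0 $ k = 0"
      by (simp add: v0)
    then have "(\<Sum>j\<in>UNIV. to_ac (A $ i $ j) * v j) - t * (\<Sum>j\<in>UNIV. to_ac (B $ i $ j) * v j) = 0"
      by (simp add: matrix_vector_mult_def v_def mat_scale_def sum_3 algebra_simps
          add_divide_distrib diff_divide_distrib)
    then show ?thesis
      by simp
  qed
  have fv: "(\<Sum>j\<in>UNIV. to_ac (A $ i $ j) * frob (v j)) = frob t * (\<Sum>j\<in>UNIV. to_ac (B $ i $ j) * frob (v j))"
    if "\<And>i. (\<Sum>j\<in>UNIV. to_ac (A $ i $ j) * v j) = t * (\<Sum>j\<in>UNIV. to_ac (B $ i $ j) * v j)" for v t i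
    using arg_cong[OF that[of i], of frob] by simp
  note v' = fv[OF v]
  note v'' = fv[OF v']
  note v''' = fv[OF v'', unfolded t(2)]
  define P :: "'a alg_closure^3^3" where
    "P = (\<chi> i. vector [v i, frob (v i), frob (frob (v i))])"
  define D :: "'a alg_closure^3^3" where
    "D = vector [vector [t, 0, 0], vector [0, frob t, 0], vector [0, 0, frob (frob t)]]"
  have Pn [simp]: "P $ i $ 1 = v i" "P $ i $ 2 = frob (v i)" "P $ i $ 3 = frob (frob (v i))" for i
    by (simp_all add: P_def)
  have Dn: "(D *v u) $ 1 = t * u $ 1" "(D *v u) $ 2 = frob t * u $ 2" "(D *v u) $ 3 = frob (frob t) * u $ 3" for u
    by (simp_all add: D_def matrix_vector_mult_def sum_3)
  have APD: "lift_mat A ** P = lift_mat B ** P ** D"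
    using v v' v'' unfolding vec_eq_iff forall_3
    by (simp add: matrix_matrix_mult_def sum_3 D_def mult.commute)
  have "invertible (lift_mat B)"
    using det(1) by (simp add: invertible_det_nz det_lift_mat)
  then obtain Bi where Bi: "Bi ** lift_mat B = mat 1"
    unfolding invertible_def by blast
  have BA: "(Bi ** lift_mat A) *v (P *v u) = P *v (D *v u)" for u
  proof -
    have "(Bi ** lift_mat A) *v (P *v u) = (Bi ** (lift_mat A ** P)) *v u"
      by (simp only: matrix_vector_mul_assoc matrix_mul_assoc)
    also have "Bi ** (lift_mat A ** P) = (Bi ** lift_mat B) ** (P ** D)"
      by (simp only: APD matrix_mul_assoc)
    finally show ?thesis
      by (simp add: Bi matrix_vector_mul_assoc)
  qed
  \<comment> \<open>The kernel of \<open>P\<close> is stable under \<open>D\<close>. Row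
    \<open>k\<close> of \<open>P\<close> consists of ones, so reading it off for u, D u and D^2 u
    gives a Vandermonde system.\<close>
  have inj: "u = 0" if "P *v u = 0" for u
  proof -
    have 1: "P *v (D *v u) = 0"
      using BA[of u] that by simp
    have 2: "P *v (D *v (D *v u)) = 0"
      using BA[of "D *v u"] 1 by simp
    have row: "w $ 1 + w $ 2 + w $ 3 = 0" if "P *v w = 0" for w
      using arg_cong[OF that, of "\<lambda>x. x $ k"] by (simp add: matrix_vector_mult_def sum_3 vk)
    have e1: "u $ 1 * t + u $ 2 * frob t + u $ 3 * frob (frob t) = 0"
      using row[OF 1] unfolding Dn by (simp only: mult_ac)
    have e2: "u $ 1 * t * t + u $ 2 * frob t * frob t + u $ 3 * frob (frob t) * frob (frob t) = 0"
      using row[OF 2] unfolding Dn by (simp only: mult_ac)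
    have ne: "t \<noteq> frob t" "t \<noteq> frob (frob t)" "frob t \<noteq> frob (frob t)"
      using t(3,4) by auto
    show ?thesis
      using vandermonde_3[OF ne row[OF that] e1 e2] by (simp add: vec_eq_iff forall_3)
  qed
  then have "\<exists>Q. Q ** P = mat 1"
    unfolding matrix_left_invertible_ker by simp
  then obtain Q where "Q ** P = mat 1" ..
  then have PQ: "P ** Q = mat 1"
    using matrix_left_right_inverse by blast
  have inv: "invertible P"
    using \<open>Q ** P = mat 1\<close> PQ unfolding invertible_def by blast
  \<comment> \<open>The third conjugate \<open>w\<close> of the eigenvector has the same eigenvalue
    \<open>t\<close>, so it is a multiple of the eigenvector, and coordinate \<open>k\<close> shows
    that the factor is 1.\<close>
  have v3: "frob (frob (frob (v i))) = v i" for i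
  proof -
    define w :: "'a alg_closure^3" where "w = (\<chi> i. frob (frob (frob (v i))))"
    define u where "u = Q *v w"
    have w: "w = P *v u"
      by (simp add: u_def matrix_vector_mul_assoc PQ)
    have "lift_mat A *v w = t *s (lift_mat B *v w)"
      using v''' by (simp add: vec_eq_iff matrix_vector_mult_def w_def)
    then have "(Bi ** lift_mat A) *v w = t *s w"
      unfolding matrix_vector_mul_assoc[symmetric]
      by (simp add: vector_scalar_commute Bi matrix_vector_mul_assoc)
    then have "P *v (D *v u) = P *v (t *s u)"
      using BA[of u] by (simp add: w vector_scalar_commute)
    then have "P *v (D *v u - t *s u) = 0"
      by (simp add: matrix_vector_mult_diff_distrib)
    then have "D *v u - t *s u = 0"
      by (rule inj)
    then have "(D *v u) $ i = t * u $ i" for i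
      by (simp add: vec_eq_iff)
    from this[of 2] this[of 3] have "u $ 2 = 0" "u $ 3 = 0"
      using t(3,4) by (auto simp: Dn)
    then have wv: "w $ i = v i * u $ 1" for i
      by (simp add: w matrix_vector_mult_def sum_3)
    have "u $ 1 = 1"
      using wv[of k] by (simp add: w_def vk)
    then show ?thesis
      using wv[of i] by (simp add: w_def)
  qed
  have frame: "frob_frame P"
    unfolding frob_frame_iff using inv by (simp add: v3)
  have AD: "gram P A = gram P B ** D"
    by (simp add: gram_def APD flip: matrix_mul_assoc)
  have ABn: "gram P A $ i $ 1 = gram P B $ i $ 1 * t" "gram P A $ i $ 2 = gram P B $ i $ 2 * frob t" for i
    unfolding AD by (simp_all add: matrix_matrix_mult_def sum_3 D_def)
  have s: "gram P M $ 2 $ 1 = gram P M $ 1 $ 2" if "transpose M = M" for M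
    using arg_cong[OF transpose_gram[OF that, of P], of "\<lambda>H. H $ 1 $ 2"] by (simp add: transpose_def)
  \<comment> \<open>By symmetry of both Gram matrices, the (1,2) and (2,1) entries of A compare B_12
    multiplied by two different eigenvalues.\<close>
  have "gram P B $ 1 $ 2 * frob t = gram P B $ 1 $ 2 * t"
    using ABn s[OF sym(1)] s[OF sym(2)] by metis
  then have B12: "gram P B $ 1 $ 2 = 0"
    using t(3) by simp
  define d where "d = gram P B $ 1 $ 1"
  have gB: "gram P B = hmat d 0"
    using gram_eq_hmat(1)[OF frame sym(2)] by (simp add: B12 d_def)
  moreover have "gram P A = hmat (d * t) 0"
    using gram_eq_hmat(1)[OF frame sym(1)] by (simp add: ABn B12 d_def)
  moreover have "d \<noteq> 0"
  proof
    assume "d = 0"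
    then have "gram P B = 0"
      by (simp add: gB vec_eq_iff forall_3)
    then have "B = 0"
      using gram_eq_0_imp[OF frame] by blast
    then show False
      using det(1) by (simp add: det_3)
  qed
  ultimately show ?thesis
    using that frame t(2,3) by blast
qed


section \<open>Codes containing a codeword with off-diagonal entry 1\<close>

lemma perfect_msrd_code_spanned:
  fixes C :: "('a::{field,finite}^3^3) set"
  assumes C: "C \<in> perfect_msrd_codes" "A \<in> C" "B \<in> C" "D \<in> C"
    and indep: "\<And>r s u. mat_scale r A + mat_scale s B + mat_scale u D = 0 \<Longrightarrow> r = 0 \<and> s = 0 \<and> u = 0"
    and M: "M \<in> C"
  obtains r s u where "M = mat_scale r A + mat_scale s B + mat_scale u D"
proof -
  let ?f = "\<lambda>(r, s, u). mat_scale r A + mat_scale s B + mat_scale u D"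
  have sub: "matvs.subspace C"
    using C(1) nonsingular_codeD(1) by (auto simp: perfect_msrd_codes_iff)
  have "inj ?f"
  proof (rule injI)
    fix x y assume eq: "?f x = ?f y"
    obtain r s u r' s' u' where xy: "x = (r, s, u)" "y = (r', s', u')"
      using prod_cases3 by metis
    have "mat_scale (r - r') A + mat_scale (s - s') B + mat_scale (u - u') D = 0"
      using eq by (simp add: xy matvs.scale_left_diff_distrib algebra_simps)
    from indep[OF this] show "x = y"
      by (simp add: xy)
  qed
  \<comment> \<open>The combinations are already q^3 distinct codewords, so they exhaust the
    code.\<close>
  then have "card (range ?f) = CARD('a) ^ 3"
    by (simp add: card_image power3_eq_cube)
  moreover have "range ?f \<subseteq> C"
    using C(2-4) sub by (auto intro!: matvs.subspace_add matvs.subspace_scale)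
  ultimately have "range ?f = C"
    using C(1) by (intro card_subset_eq) (auto simp: perfect_msrd_codes_iff)
  then have "M \<in> range ?f"
    using M by simp
  then show ?thesis
    using that by auto
qed

text \<open>
  Elements \<open>w\<close> of the cubic field with \<open>Tr (c * w) = k\<close> yield the codewords with Gram matrix
  \<open>hmat (1 + w) 1\<close>, of determinant \<open>e\<^sub>3(w) + e\<^sub>2(w) = N(w) * (1 + Tr (1 / w))\<close>. This vanishes for
  \<open>w = - Tr v / v\<close>, which has \<open>Tr (c * w) = - Tr v * Tr (c / v)\<close>.
\<close>

lemma perfect_msrd_code_subset_twisted:
  fixes C :: "('a::{field,finite}^3^3) set"
  assumes q: "2 < CARD('a)" and C: "C \<in> perfect_msrd_codes" "A \<in> C" "B \<in> C" "D \<in> C"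
    and P: "frob_frame P" and B: "gram P B = hmat d 0" and A: "gram P A = hmat (d * t) 0"
    and D: "gram P D = hmat a 1"
    and d: "d \<noteq> 0" and t: "frob (frob (frob t)) = t" "frob t \<noteq> t"
  shows "(2 :: 'a alg_closure) \<noteq> 0 \<and> C \<subseteq> twisted_field_code P"
proof -
  have ns: "nonsingular_code C"
    using C(1) by (simp add: perfect_msrd_codes_iff)
  note sub = nonsingular_codeD(1)[OF ns] and sym = nonsingular_codeD(2)[OF ns]
  have K: "frob (frob (frob d)) = d" "frob (frob (frob a)) = a"
    using gram_eq_hmat(2)[OF P sym] C(3,4) by (metis B hmat_nth(1), metis D hmat_nth(1))
  have span: "\<exists>r s u. M = mat_scale r A + mat_scale s B + mat_scale u D" if M: "M \<in> C" for M
  proof -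
    have indep: "r = 0 \<and> s = 0 \<and> u = 0" if "mat_scale r A + mat_scale s B + mat_scale u D = 0" for r s u
    proof -
      have g: "gram P (mat_scale r A + mat_scale s B + mat_scale u D) $ i $ j = 0" for i j
        unfolding that by (simp add: gram_0)
      have u: "u = 0"
        using g[of 1 2] by (simp add: gram_add gram_scale A B D)
      then have "d * (to_ac r * t + to_ac s) = 0"
        using g[of 1 1] by (simp add: gram_add gram_scale A B D algebra_simps)
      then have rs: "to_ac r * t + to_ac s = 0"
        using d by simp
      have r: "r = 0"
      proof (rule ccontr)
        assume "r \<noteq> 0"
        then have "t = to_ac (- s / r)"
          using rs by (simp add: field_simps eq_neg_iff_add_eq_0)
        then show False
          using t(2) by simp
      qed
      with rs u show ?thesis
        by simp
    qed
    obtain r s u where "M = mat_scale r A + mat_scale s B + mat_scale u D"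
      using perfect_msrd_code_spanned[OF C(1-4) indep M] .
    then show ?thesis
      by blast
  qed
  define Tr where "Tr x = x + frob x + frob (frob x)" for x :: "'a alg_closure"
  have Tr_add: "Tr (x + y) = Tr x + Tr y" and Tr_diff: "Tr (x - y) = Tr x - Tr y" for x y
    by (simp_all add: Tr_def algebra_simps)
  have Tr_scale: "Tr (to_ac r * x) = to_ac r * Tr x" for r x
    by (simp add: Tr_def algebra_simps)
  \<comment> \<open>Chosen so that Tr (c x) vanishes at x = d and x = d t: the norm of
    \<open>d\<close> comes out and the remaining terms cancel cyclically.\<close>
  define c where "c = frob d * frob (frob d) * (frob (frob t) - frob t)"
  have c0: "c \<noteq> 0"
    using d t by (simp add: c_def)
  have cK: "frob (frob (frob c)) = c"
    by (simp add: c_def K t)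
  have Tr_cd: "Tr (c * d) = 0" "Tr (c * (d * t)) = 0"
    unfolding Tr_def c_def by (simp_all add: K t algebra_simps)
  define k where "k = Tr (c * (a - 1))"
  have hit: "w * frob w + frob w * frob (frob w) + frob (frob w) * w + w * frob w * frob (frob w) \<noteq> 0"
    if w: "frob (frob (frob w)) = w" "Tr (c * w) = k" for w
  proof
    assume zero: "w * frob w + frob w * frob (frob w) + frob (frob w) * w + w * frob w * frob (frob w) = 0"
    \<comment> \<open>Tr (c w) = k means Tr (c d y) = 0. This will place \<open>y\<close> in the
      span of 1 and \<open>t\<close> over the ground field, so that a codeword with first Gram entry
      1 + w exists.\<close>
    define y where "y = (a - 1 - w) / d"
    have "Tr (c * (d * y)) = Tr (c * (a - 1) - c * w)"
      using d by (simp add: y_def algebra_simps)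
    then have "Tr (c * (d * y)) = 0"
      unfolding Tr_diff w(2) k_def by simp
    moreover have "Tr (c * (d * y)) = d * frob d * frob (frob d) *
        ((frob (frob t) - frob t) * y + (t - frob (frob t)) * frob y + (frob t - t) * frob (frob y))"
      unfolding Tr_def c_def by (simp add: K t algebra_simps)
    ultimately have y0: "(frob (frob t) - frob t) * y + (t - frob (frob t)) * frob y + (frob t - t) * frob (frob y) = 0"
      using d by simp
    \<comment> \<open>The slope of \<open>y\<close> against \<open>t\<close>. The relation
      \<open>y0\<close> says that it equals its conjugate, so \<open>s\<close> and then y - s t lie
      in the ground field.\<close>
    define s where "s = (y - frob y) / (t - frob t)"
    have "frob s = (frob y - frob (frob y)) / (frob t - frob (frob t))"
      by (simp add: s_def)
    also have "\<dots> = s"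
    proof -
      have "(frob y - frob (frob y)) * (t - frob t) - (y - frob y) * (frob t - frob (frob t)) =
        (frob (frob t) - frob t) * y + (t - frob (frob t)) * frob y + (frob t - t) * frob (frob y)"
        by (simp add: algebra_simps)
      then have e: "(frob y - frob (frob y)) * (t - frob t) = (y - frob y) * (frob t - frob (frob t))"
        unfolding y0 by simp
      have "t - frob t \<noteq> 0" "frob t - frob (frob t) \<noteq> 0"
        using t(2) by auto
      then show ?thesis
        unfolding s_def using frac_eq_eq[THEN iffD2, OF _ _ e] by blast
    qed
    finally have fs: "frob s = s" .
    then obtain s0 where s0: "s = to_ac s0"
      using frob_fixed_iff by blast
    have "frob (y - s * t) = y - s * t"
    proof -
      have "s * (t - frob t) = y - frob y"
        using t(2) by (simp add: s_def)
      then have "frob y - s * frob t = y - s * t"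
        by (simp add: algebra_simps)
      then show ?thesis
        using fs by simp
    qed
    then obtain r0 where r0: "y - s * t = to_ac r0"
      using frob_fixed_iff by blast
    have dy: "d * y = d * to_ac r0 + d * t * to_ac s0"
      unfolding r0[symmetric] s0[symmetric] by (simp add: algebra_simps)
    define M where "M = D - mat_scale r0 B - mat_scale s0 A"
    have MC: "M \<in> C"
      unfolding M_def using C sub by (auto intro!: matvs.subspace_diff matvs.subspace_scale)
    have "gram P M $ 1 $ 1 = a - d * y"
      unfolding dy M_def gram_diff gram_scale A B D by (simp add: algebra_simps)
    then have M11: "gram P M $ 1 $ 1 = 1 + w"
      using d by (simp add: y_def)
    have M12: "gram P M $ 1 $ 2 = 1"
      by (simp add: M_def gram_diff gram_scale A B D)
    have "M \<noteq> 0"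
      using M12 by (auto simp: gram_0)
    then have "det M \<noteq> 0"
      using nonsingular_codeD(3)[OF ns MC] by blast
    then have "det (gram P M) \<noteq> 0"
      using P by (simp add: det_gram frob_frame_def invertible_det_nz)
    moreover have "gram P M = hmat (1 + w) 1"
      using gram_eq_hmat(1)[OF P sym[OF MC]] by (simp add: M11 M12)
    moreover have "det (hmat (1 + w) 1) =
        w * frob w + frob w * frob (frob w) + frob (frob w) * w + w * frob w * frob (frob w)"
      by (simp add: det_hmat algebra_simps)
    ultimately show False
      using zero by simp
  qed
  have k0: "k \<noteq> 0"
    using hit[of 0] by (auto simp: Tr_def)
  have fk: "frob k = k"
    by (simp add: k_def Tr_def K cK add_ac)
  have special: "frob c = c \<and> - k = c"
  proof (rule ccontr)
    assume "\<not> (frob c = c \<and> - k = c)"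
    then obtain v where v: "v \<noteq> 0" "frob (frob (frob v)) = v"
      "(v + frob v + frob (frob v)) *
        (c * frob v * frob (frob v) + frob c * frob (frob v) * v + frob (frob c) * v * frob v) =
        - k * v * frob v * frob (frob v)"
      using frob3_fixed_trace_product[OF q cK c0, of "- k"] fk by auto
    define w where "w = - Tr v / v"
    have fT: "frob (Tr v) = Tr v"
      by (simp add: Tr_def v(2) add_ac)
    have wv: "w * v = - Tr v"
      using v(1) by (simp add: w_def)
    have wv1: "frob w * frob v = - Tr v"
      using arg_cong[OF wv, of frob] by (simp add: fT)
    have wv2: "frob (frob w) * frob (frob v) = - Tr v"
      using arg_cong[OF wv1, of frob] by (simp add: fT)
    have "Tr (c * w) * (v * frob v * frob (frob v)) = c * (w * v) * (frob v * frob (frob v))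
        + frob c * (frob w * frob v) * (frob (frob v) * v)
        + frob (frob c) * (frob (frob w) * frob (frob v)) * (v * frob v)"
      by (simp add: Tr_def[of "c * w"] algebra_simps)
    also have "\<dots> = - (Tr v * (c * frob v * frob (frob v)
        + frob c * frob (frob v) * v + frob (frob c) * v * frob v))"
      unfolding wv wv1 wv2 by (simp add: algebra_simps)
    also have "\<dots> = k * (v * frob v * frob (frob v))"
      using v(3) unfolding Tr_def[of v] by (simp add: algebra_simps)
    finally have "Tr (c * w) = k"
      using v(1) by simp
    moreover have "frob (frob (frob w)) = w"
      by (simp add: w_def fT v(2))
    moreover have "w * frob w + frob w * frob (frob w) + frob (frob w) * w + w * frob w * frob (frob w) = 0"
    proof -
      have "(w * frob w + frob w * frob (frob w) + frob (frob w) * w + w * frob w * frob (frob w)) *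
          (v * frob v * frob (frob v)) = (w * v) * (frob w * frob v) * frob (frob v)
          + (frob w * frob v) * (frob (frob w) * frob (frob v)) * v
          + (frob (frob w) * frob (frob v)) * (w * v) * frob v
          + (w * v) * (frob w * frob v) * (frob (frob w) * frob (frob v))"
        by (simp add: algebra_simps)
      also have "\<dots> = (Tr v)\<^sup>2 * (v + frob v + frob (frob v)) - (Tr v) ^ 3"
        unfolding wv wv1 wv2 by (simp add: algebra_simps power2_eq_square power3_eq_cube)
      also have "\<dots> = 0"
        unfolding Tr_def[symmetric] by (simp add: power2_eq_square power3_eq_cube)
      finally show ?thesis
        using v(1) by simp
    qed
    ultimately show False
      using hit by blast
  qed
  have kc: "k = - c"
    using special by (simp add: minus_equation_iff[of k])
  have Tr_c: "Tr (c * x) = c * Tr x" for x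
    using special by (simp add: Tr_def algebra_simps)
  \<comment> \<open>In characteristic 2 the element w = 1 satisfies Tr (c w) = 3 c = -c = k and
    would give a codeword with Gram determinant 4 = 0.\<close>
  have "(2 :: 'a alg_closure) \<noteq> 0"
  proof
    assume 2: "(2 :: 'a alg_closure) = 0"
    have "Tr (c * 1) - k = 2 * (2 * c)"
      unfolding Tr_c kc by (simp add: Tr_def)
    then have "Tr (c * 1) = k"
      using 2 by simp
    then have "(2 * 2 :: 'a alg_closure) \<noteq> 0"
      using hit[of 1] by simp
    then show False
      using 2 by simp
  qed
  moreover have "C \<subseteq> twisted_field_code P"
  proof
    fix M assume M: "M \<in> C"
    then obtain r s u where M_eq: "M = mat_scale r A + mat_scale s B + mat_scale u D"
      using span by blast
    define g where "g = gram P M $ 1 $ 1"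
    have g12: "gram P M $ 1 $ 2 = to_ac u"
      by (simp add: M_eq gram_add gram_scale A B D)
    have g: "g = to_ac r * (d * t) + to_ac s * d + to_ac u * a"
      by (simp add: g_def M_eq gram_add gram_scale A B D)
    \<comment> \<open>With \<open>c\<close> in the ground field, k = c (Tr a - 3), and k = -c yields
      Tr a = 2. The basis elements d and d t have trace 0.\<close>
    have "c * Tr a = k + Tr (c * 1)"
      unfolding Tr_c[symmetric] k_def by (simp add: Tr_add[symmetric] algebra_simps)
    also have "\<dots> = 2 * c"
      unfolding Tr_c kc by (simp add: Tr_def)
    finally have Tr_a: "Tr a = 2"
      using c0 by simp
    have "c * Tr (d * t) = 0" "c * Tr d = 0"
      using Tr_cd by (simp_all add: Tr_c)
    then have "Tr (d * t) = 0" "Tr d = 0"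
      using c0 by simp_all
    then have "Tr g = 2 * to_ac u"
      unfolding g Tr_add Tr_scale Tr_a by simp
    then have "g + frob g + frob (frob g) = 2 * to_ac u"
      by (simp add: Tr_def)
    moreover have "gram P M = hmat g (to_ac u)"
      using gram_eq_hmat(1)[OF P sym[OF M]] by (simp add: g_def g12)
    ultimately show "M \<in> twisted_field_code P"
      using sym[OF M] by (simp add: twisted_field_code_def)
  qed
  ultimately show ?thesis ..
qed


section \<open>Rescaling frames and the classification\<close>

lemma gram_mult: "gram (P ** S) M = transpose S ** gram P M ** S"
  by (simp add: gram_def matrix_transpose_mul matrix_mul_assoc)

text \<open>For y = b the new off-diagonal entry is the norm of \<open>b\<close>. It lies in the
  ground field, so a scalar multiple of the codeword has off-diagonal entry 1.\<close>

lemma rescale_hmat: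
  assumes "frob (frob (frob b)) = b"
  defines "S \<equiv> vector [vector [frob b, 0, 0], vector [0, frob (frob b), 0], vector [0, 0, b]]"
  shows "transpose S ** hmat x y ** S = hmat ((frob b)\<^sup>2 * x) (frob b * frob (frob b) * y)"
  by (simp add: S_def vec_eq_iff forall_3 matrix_matrix_mult_def sum_3 transpose_def assms(1)
      power2_eq_square)

text \<open>It suffices to embed the code in a field code or twisted field code, since a perfect
  code has the largest size a nonsingular code can have.\<close>

theorem perfect_msrd_code_classification:
  fixes C :: "('a::{field,finite}^3^3) set"
  assumes q: "2 < CARD('a)" and C: "C \<in> perfect_msrd_codes"
  shows "\<exists>P. frob_frame P \<and>
    (C = field_code P \<or> (2 :: 'a alg_closure) \<noteq> 0 \<and> C = twisted_field_code P)"
proof -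
  have ns: "nonsingular_code C" and card: "card C = CARD('a) ^ 3"
    using C by (simp_all add: perfect_msrd_codes_iff)
  note sub = nonsingular_codeD(1)[OF ns] and sym = nonsingular_codeD(2)[OF ns]
  have big: "CARD('a) < card C"
    unfolding card using q power_strict_increasing[of 1 3 "CARD('a)"] by simp
  have small: "\<not> C \<subseteq> range (\<lambda>c. mat_scale c M)" for M
  proof
    assume "C \<subseteq> range (\<lambda>c. mat_scale c M)"
    then have "card C \<le> card (range (\<lambda>c. mat_scale c M))"
      by (intro card_mono) auto
    also have "\<dots> \<le> CARD('a)"
      by (rule card_image_le) simp
    finally show False
      using big by simp
  qed
  obtain B where B: "B \<in> C" "B \<noteq> 0"
    using small[of 0] by (auto simp: matvs.scale_zero_right)
  obtain A where A: "A \<in> C" "A \<notin> range (\<lambda>c. mat_scale c B)"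
    using small[of B] by blast
  have "det B \<noteq> 0"
    using nonsingular_codeD(3)[OF ns] B by blast
  moreover have "det (A - mat_scale c B) \<noteq> 0" for c
  proof (rule nonsingular_codeD(3)[OF ns])
    show "A - mat_scale c B \<in> C"
      using A B sub by (auto intro!: matvs.subspace_diff matvs.subspace_scale)
    show "A - mat_scale c B \<noteq> 0"
      using A by auto
  qed
  ultimately obtain P d t where P: "frob_frame P" "gram P B = hmat d 0" "gram P A = hmat (d * t) 0" "d \<noteq> 0"
    "frob (frob (frob t)) = t" "frob t \<noteq> t"
    using exists_diagonalising_frame[OF sym[OF A(1)] sym[OF B(1)]] by metis
  show ?thesis
  proof (cases "\<forall>M\<in>C. gram P M $ 1 $ 2 = 0")
    case True
    then have "C \<subseteq> field_code P"
      using sym by (auto simp: field_code_def)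
    then have "C = field_code P"
      using perfect_msrd_code_eqI[OF C nonsingular_field_code[OF P(1)]] by blast
    with P(1) show ?thesis
      by blast
  next
    case False
    then obtain D where D: "D \<in> C" "gram P D $ 1 $ 2 \<noteq> 0"
      by blast
    define b where "b = gram P D $ 1 $ 2"
    have bK: "frob (frob (frob b)) = b"
      unfolding b_def by (rule gram_eq_hmat(3)[OF P(1) sym[OF D(1)]])
    have b0: "b \<noteq> 0"
      using D by (simp add: b_def)
    define S :: "'a alg_closure^3^3" where
      "S = vector [vector [frob b, 0, 0], vector [0, frob (frob b), 0], vector [0, 0, b]]"
    have "twisted S"
      by (simp add: twisted_iff S_def bK)
    moreover have "invertible S"
      using b0 by (simp add: invertible_det_nz det_3 S_def)
    ultimately have PS: "frob_frame (P ** S)"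
      using frob_frame_mult_twisted P(1) by blast
    note gS = gram_mult[of P S] rescale_hmat[OF bK, folded S_def]
    have gB: "gram (P ** S) B = hmat ((frob b)\<^sup>2 * d) 0"
      unfolding gS P(2) by simp
    have gA: "gram (P ** S) A = hmat ((frob b)\<^sup>2 * d * t) 0"
      unfolding gS P(3) by (simp add: mult.assoc)
    define n where "n = frob b * frob (frob b) * b"
    have "gram P D = hmat (gram P D $ 1 $ 1) b"
      unfolding b_def by (rule gram_eq_hmat(1)[OF P(1) sym[OF D(1)]])
    then have gD: "gram (P ** S) D $ 1 $ 2 = n"
      unfolding gS(1) by (metis gS(2) hmat_nth(2) n_def)
    have "frob n = n"
      by (simp add: n_def bK)
    then obtain n0 where n0: "n = to_ac n0"
      using frob_fixed_iff by blast
    have nn: "n0 \<noteq> 0"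
      using b0 n0 by (auto simp: n_def)
    define D' where "D' = mat_scale (1 / n0) D"
    have D': "D' \<in> C"
      unfolding D'_def using D sub by (auto intro!: matvs.subspace_scale)
    have "gram (P ** S) D' $ 1 $ 2 = 1"
      using nn by (simp add: D'_def gram_scale gD n0)
    then have gD': "gram (P ** S) D' = hmat (gram (P ** S) D' $ 1 $ 1) 1"
      using gram_eq_hmat(1)[OF PS sym[OF D']] by simp
    have "(frob b)\<^sup>2 * d \<noteq> 0"
      using b0 P(4) by simp
    from perfect_msrd_code_subset_twisted[OF q C A(1) B(1) D' PS gB gA gD' this P(5,6)]
    have 2: "(2 :: 'a alg_closure) \<noteq> 0" "C \<subseteq> twisted_field_code (P ** S)"
      by blast+
    then have "C = twisted_field_code (P ** S)"
      using perfect_msrd_code_eqI[OF C nonsingular_twisted_field_code[OF PS 2(1)]] by blast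
    with PS 2(1) show ?thesis
      by blast
  qed
qed

text \<open>
  Codes equivalent to a field code satisfy \<open>U Y\<inverse> Z = Z Y\<inverse> U\<close>, because the quotients \<open>U Y\<inverse>\<close> commute.
\<close>

lemma field_code_commute:
  assumes P: "frob_frame P" and U: "U \<in> field_code P" and Y: "Y \<in> field_code P" and Z: "Z \<in> field_code P"
    and R: "Y ** R = mat 1"
  shows "U ** R ** Z = Z ** R ** U"
proof -
  obtain Q where Q: "P ** Q = mat 1" "Q ** P = mat 1"
    using frob_frame_inverse[OF P] by metis
  have Q': "transpose Q ** transpose P = mat 1" "transpose P ** transpose Q = mat 1"
    by (simp_all add: Q flip: matrix_transpose_mul)
  have diag: "\<exists>a. gram P M = hmat a 0" if "M \<in> field_code P" for M
    using gram_eq_hmat(1)[OF P, of M] that by (auto simp: field_code_def)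
  \<comment> \<open>In the basis of the frame, \<open>G\<close> represents \<open>R\<close>. It is
    inverse to the diagonal matrix \<open>gram P Y\<close>, hence diagonal, and diagonal matrices
    commute.\<close>
  define G where "G = Q ** lift_mat R ** transpose Q"
  have lift: "lift_mat M = transpose Q ** gram P M ** Q" for M
  proof -
    have "transpose Q ** gram P M ** Q = (transpose Q ** transpose P) ** lift_mat M ** (P ** Q)"
      by (simp only: gram_def matrix_mul_assoc)
    then show ?thesis
      by (simp add: Q Q')
  qed
  have "gram P Y ** G = transpose P ** (lift_mat Y ** lift_mat R) ** transpose Q"
  proof -
    have "gram P Y ** G = transpose P ** lift_mat Y ** (P ** Q) ** lift_mat R ** transpose Q"
      by (simp only: gram_def G_def matrix_mul_assoc)
    then show ?thesis
      by (simp add: Q matrix_mul_assoc)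
  qed
  then have YG: "gram P Y ** G = mat 1"
    by (simp add: R Q' flip: lift_mat_mult)
  obtain y where y: "gram P Y = hmat y 0"
    using diag[OF Y] by blast
  have "y \<noteq> 0"
  proof
    assume "y = 0"
    then have "det (gram P Y ** G) = 0"
      by (simp add: y det_mul det_hmat)
    then show False
      by (simp add: YG)
  qed
  then have G: "G $ i $ j = 0" if "i \<noteq> j" for i j
    using YG that unfolding y vec_eq_iff forall_3
    using exhaust_3[of i] exhaust_3[of j] by (auto simp: matrix_matrix_mult_def sum_3 mat_def)
  have comm: "hmat u 0 ** G ** hmat z 0 = hmat z 0 ** G ** hmat u 0" for u z
    by (simp add: vec_eq_iff forall_3 matrix_matrix_mult_def sum_3 G)
  have eq: "lift_mat (M ** R ** N) = transpose Q ** (gram P M ** G ** gram P N) ** Q" for M N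
    by (simp add: lift_mat_mult lift[of M] lift[of N] G_def matrix_mul_assoc)
  have "lift_mat (U ** R ** Z) = lift_mat (Z ** R ** U)"
    unfolding eq using diag[OF U] diag[OF Z] comm by metis
  then show ?thesis
    by simp
qed

text \<open>If the identity held, then for diagonal codewords \<open>U\<close> and \<open>Y\<close>
  the quotient \<open>V\<close> would have a symmetric product with every codeword \<open>Z\<close>.
  A codeword with nonzero off-diagonal entries rules this out when \<open>V\<close> has distinct
  eigenvalues.\<close>

lemma not_code_equivalent_twisted:
  fixes P :: "'a::{field,finite} alg_closure^3^3"
  assumes P: "frob_frame P" and 2: "(2 :: 'a alg_closure) \<noteq> 0"
  shows "\<not> code_equivalent (field_code P) (twisted_field_code P)"
proof
  assume "code_equivalent (field_code P) (twisted_field_code P)"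
  then obtain A B where AB: "invertible A" "invertible B"
    and T: "twisted_field_code P = {A ** M ** B | M. M \<in> field_code P}"
    unfolding code_equivalent_def by blast
  obtain A' where A': "A' ** A = mat 1"
    using AB(1) unfolding invertible_def by blast
  have comm: "U ** R ** Z = Z ** R ** U" if UYZ: "U \<in> twisted_field_code P" "Y \<in> twisted_field_code P"
    "Z \<in> twisted_field_code P" "Y ** R = mat 1" for U Y Z R
  proof -
    obtain U1 Y1 Z1 where 1: "U = A ** U1 ** B" "Y = A ** Y1 ** B" "Z = A ** Z1 ** B"
      "U1 \<in> field_code P" "Y1 \<in> field_code P" "Z1 \<in> field_code P"
      using UYZ(1-3) unfolding T by blast
    have "Y1 ** (B ** R ** A) = (A' ** A) ** Y1 ** B ** R ** A"
      by (simp add: A' matrix_mul_assoc)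
    also have "\<dots> = A' ** (Y ** R) ** A"
      by (simp only: 1 matrix_mul_assoc)
    finally have "Y1 ** (B ** R ** A) = mat 1"
      using UYZ(4) A' by simp
    from field_code_commute[OF P 1(4) 1(5) 1(6) this]
    have "A ** (U1 ** (B ** R ** A) ** Z1) ** B = A ** (Z1 ** (B ** R ** A) ** U1) ** B"
      by (rule arg_cong)
    then show ?thesis
      unfolding 1 by (simp only: matrix_mul_assoc)
  qed
  obtain t :: "'a alg_closure" where t: "frob (frob (frob t)) = t" "frob t \<noteq> t"
    by (rule exists_frob3_fixed)
  have t2: "frob (frob t) \<noteq> t"
    using t by (metis frob_eq_iff)
  let ?Tr = "\<lambda>x :: 'a alg_closure. x + frob x + frob (frob x)"
  \<comment> \<open>Both elements have trace 0, so they occur in diagonal codewords. Their quotient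
    t + frob t differs from its conjugate.\<close>
  let ?y = "t - frob t" and ?u = "t\<^sup>2 - (frob t)\<^sup>2"
  obtain Y where Y: "Y \<in> twisted_field_code P" "gram P Y = hmat ?y 0"
    using exists_in_twisted_field_code[OF P 2, of ?y] t(1) by auto
  obtain U where U: "U \<in> twisted_field_code P" "gram P U = hmat ?u 0"
    using exists_in_twisted_field_code[OF P 2, of ?u] t(1) by auto
  have "\<exists>z. frob (frob (frob z)) = z \<and> ?Tr z \<noteq> 0"
  proof (rule ccontr)
    assume "\<not> ?thesis"
    then have "?Tr z = 0" if "frob (frob (frob z)) = z" for z
      using that by blast
    from this[of 1] this[of t] this[of "t\<^sup>2"]
    have 0: "?Tr 1 = 0" "?Tr t = 0" "?Tr (t\<^sup>2) = 0"
      using t(1) by simp_all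
    \<comment> \<open>Summing (X - t') (X - t'') over the three conjugates X of \<open>t\<close>
      leaves only the term X = t.\<close>
    have "(t - frob t) * (t - frob (frob t)) = ?Tr (t\<^sup>2) - (frob t + frob (frob t)) * ?Tr t
        + frob t * frob (frob t) * ?Tr 1"
      by (simp add: algebra_simps power2_eq_square)
    then show False
      unfolding 0 using t t2 by simp
  qed
  then obtain z where z: "frob (frob (frob z)) = z" "?Tr z \<noteq> 0"
    by blast
  define b where "b = ?Tr z / 2"
  obtain Z where Z: "Z \<in> twisted_field_code P" "gram P Z = hmat z b"
    using exists_in_twisted_field_code[OF P 2 z(1)] unfolding b_def .
  have b: "b \<noteq> 0"
    using z 2 by (simp add: b_def)
  have "Y \<noteq> 0"
  proof
    assume "Y = 0"
    then have "hmat ?y 0 $ 1 $ 1 = 0"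
      unfolding Y(2)[symmetric] by (simp add: gram_0)
    then show False
      using t(2) by simp
  qed
  then have "det Y \<noteq> 0"
    using nonsingular_codeD(3)[OF nonsingular_twisted_field_code[OF P 2] Y(1)] by blast
  then obtain R where R: "Y ** R = mat 1" "R ** Y = mat 1"
    using invertible_det_nz[of Y] unfolding invertible_def by blast
  note symT = nonsingular_codeD(2)[OF nonsingular_twisted_field_code[OF P 2]]
  define V where "V = U ** R"
  have UV: "U = V ** Y"
    by (simp add: V_def R flip: matrix_mul_assoc)
  have symV: "transpose (V ** Z) = V ** Z"
  proof -
    have "transpose R = transpose R ** (Y ** R)"
      by (simp add: R)
    also have "\<dots> = transpose (Y ** R) ** R"
      by (simp add: matrix_transpose_mul symT[OF Y(1)] matrix_mul_assoc)
    finally have "transpose R = R"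
      by (simp add: R)
    then have "transpose (V ** Z) = Z ** R ** U"
      by (simp add: V_def matrix_transpose_mul symT U(1) Z(1) matrix_mul_assoc)
    then show ?thesis
      using comm[OF U(1) Y(1) Z(1) R(1)] by (simp add: V_def)
  qed
  obtain Q where Q: "P ** Q = mat 1" "Q ** P = mat 1"
    using frob_frame_inverse[OF P] by metis
  have Q': "transpose Q ** transpose P = mat 1"
    by (simp add: Q flip: matrix_transpose_mul)
  \<comment> \<open>The matrix of \<open>V\<close> in the frame, acting on Gram matrices from the
    left. Comparing \<open>U = V ** Y\<close> entrywise makes it diagonal where it is
    needed.\<close>
  define H where "H = transpose P ** lift_mat V ** transpose Q"
  have HM: "gram P (V ** M) = H ** gram P M" for M
  proof -
    have "H ** gram P M = transpose P ** lift_mat V ** (transpose Q ** transpose P) ** lift_mat M ** P"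
      by (simp only: H_def gram_def matrix_mul_assoc)
    then show ?thesis
      by (simp add: Q' gram_def lift_mat_mult matrix_mul_assoc)
  qed
  have HU: "hmat ?u 0 = H ** hmat ?y 0"
    using HM[of Y] by (simp add: UV[symmetric] U(2) Y(2))
  have HUn: "hmat ?u 0 $ i $ j = (H ** hmat ?y 0) $ i $ j" for i j
    by (simp add: HU)
  have y0: "t - frob t \<noteq> 0" "frob t - frob (frob t) \<noteq> 0" "frob (frob t) - t \<noteq> 0"
    using t(2) t2 by auto
  have Hn: "H $ 1 $ 2 = 0" "H $ 1 $ 3 = 0" "H $ 2 $ 1 = 0" "H $ 2 $ 3 = 0"
    using HUn[of 1 2] HUn[of 1 3] HUn[of 2 1] HUn[of 2 3] y0
    by (simp_all add: matrix_matrix_mult_def sum_3 t(1))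
  have "H $ 1 $ 1 * (t - frob t) = (t + frob t) * (t - frob t)"
    using HUn[of 1 1] by (simp add: matrix_matrix_mult_def sum_3 power2_eq_square algebra_simps)
  then have H11: "H $ 1 $ 1 = t + frob t"
    using y0(1) by simp
  have "H $ 2 $ 2 * (frob t - frob (frob t)) = (frob t + frob (frob t)) * (frob t - frob (frob t))"
    using HUn[of 2 2] by (simp add: matrix_matrix_mult_def sum_3 power2_eq_square algebra_simps)
  then have H22: "H $ 2 $ 2 = frob t + frob (frob t)"
    using y0(2) by simp
  have "transpose (H ** hmat z b) = H ** hmat z b"
    using transpose_gram[OF symV, of P] by (simp add: HM Z(2))
  from arg_cong[OF this, of "\<lambda>M. M $ 1 $ 2"]
  have "(H ** hmat z b) $ 2 $ 1 = (H ** hmat z b) $ 1 $ 2"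
    by (simp add: transpose_def)
  then have "(frob t + frob (frob t)) * b = (t + frob t) * b"
    by (simp add: matrix_matrix_mult_def sum_3 Hn H11 H22)
  then show False
    using b t2 by simp
qed

section \<open>Counting the equivalence classes\<close>

theorem theorem3p28:
  fixes q :: nat
  assumes "q = CARD('a::{field,finite})"
  shows "(even q \<and> q > 2 \<longrightarrow>
            card ((perfect_msrd_codes :: ('a^3^3) set set) // perfect_msrd_equiv) = 1) \<and>
         (odd q \<longrightarrow>
            card ((perfect_msrd_codes :: ('a^3^3) set set) // perfect_msrd_equiv) = 2)"
proof -
  let ?r = "perfect_msrd_equiv :: (('a^3^3) set \<times> ('a^3^3) set) set"
  let ?S = "perfect_msrd_codes :: ('a^3^3) set set"
  obtain P :: "'a alg_closure^3^3" where P: "frob_frame P"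
    using exists_frob_frame by blast
  let ?F = "field_code P" and ?T = "twisted_field_code P"
  have F: "?F \<in> ?S"
    using field_code_perfect[OF P] .
  have class_eq: "?r `` {C} = ?r `` {C'}" if "C \<in> ?S" "C' \<in> ?S" "code_equivalent C C'" for C C'
  proof (rule equiv_class_eq[OF equiv_perfect_msrd])
    show "(C, C') \<in> ?r"
      using that by (simp add: perfect_msrd_equiv_def)
  qed
  have classes: "?r `` {C} = ?r `` {?F} \<or> (2 :: 'a alg_closure) \<noteq> 0 \<and> ?r `` {C} = ?r `` {?T}"
    if q: "2 < CARD('a)" and C: "C \<in> ?S" for C
  proof -
    obtain Q where Q: "frob_frame Q" "C = field_code Q \<or> (2 :: 'a alg_closure) \<noteq> 0 \<and> C = twisted_field_code Q"
      using perfect_msrd_code_classification[OF q C] by blast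
    from Q(2) show ?thesis
    proof (elim disjE conjE)
      assume "C = field_code Q"
      then show ?thesis
        using class_eq[OF C F] code_equivalent_field_code[OF Q(1) P] by blast
    next
      assume 2: "(2 :: 'a alg_closure) \<noteq> 0" and "C = twisted_field_code Q"
      then show ?thesis
        using class_eq[OF C twisted_field_code_perfect[OF P 2]] code_equivalent_twisted_field_code[OF Q(1) P]
        by blast
    qed
  qed
  have "card (?S // ?r) = 1" if "even q" "q > 2"
  proof -
    have "(2 :: 'a alg_closure) = 0"
      using that CARD_even_iff[where 'a = 'a] assms by blast
    then have "?S // ?r = {?r `` {?F}}"
      using classes that(2) F unfolding quotient_def assms by blast
    then show ?thesis
      by simp
  qed
  moreover have "card (?S // ?r) = 2" if "odd q"
  proof -
    have 2: "(2 :: 'a alg_closure) \<noteq> 0"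
      using that CARD_even_iff[where 'a = 'a] assms by blast
    have q: "2 < CARD('a)"
      using that CARD_field_ge_2[where 'a = 'a] assms by (cases "CARD('a) = 2") auto
    have T: "?T \<in> ?S"
      using twisted_field_code_perfect[OF P 2] .
    have "?S // ?r = {?r `` {?F}, ?r `` {?T}}"
      using classes[OF q] F T unfolding quotient_def by blast
    moreover have "?r `` {?F} \<noteq> ?r `` {?T}"
    proof
      assume "?r `` {?F} = ?r `` {?T}"
      then have "(?F, ?T) \<in> ?r"
        using eq_equiv_class[OF _ equiv_perfect_msrd T] by blast
      then show False
        using not_code_equivalent_twisted[OF P 2] by (simp add: perfect_msrd_equiv_def)
    qed
    ultimately show ?thesis
      by simp
  qed
  ultimately show ?thesis
    by blast
qed

end
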